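(* Let $N\ge 3$ and $\alpha\in(0,2)$. Let $u$ be a nonnegative function in $L^\infty_{\mathrm{loc}}(\mathbb{R}^N)\cap\mathcal{L}_\alpha$. If $u$ is $2$-superharmonic on $\mathbb{R}^N$, then $u$ is $\alpha$-superharmonic on $\mathbb{R}^N$.
   Context: $\mathcal{L}_\alpha$ is the set of Borel measurable functions $u:\mathbb{R}^N\to\mathbb{R}$ with $\int_{\mathbb{R}^N}\frac{|u(y)|}{(1+|y|)^{N+\alpha}}\,dy<\infty$. $(X_t)$ is the standard rotation invariant $\alpha$-stable process in $\mathbb{R}^N$, with $E^0[e^{i\langle\xi,X_t\rangle}]=e^{-t|\xi|^\alpha}$; $E^x$ is the expectation for the process started at $x$, and for an open set $U$, $\tau_U=\inf\{t>0: X_t\notin U\}$. A Borel measurable, locally integrable function $u$ on $\mathbb{R}^N$ is $\alpha$-superharmonic on $\mathbb{R}^N$ if for every bounded open set $U\subset\mathbb{R}^N$ and every $x\in U$ one has $E^x[|u(X_{\tau_U})|]<\infty$ and $u(x)\ge E^x[u(X_{\tau_U})]$. "$2$-superharmonic" means superharmonic in the classical sense, relative to the Laplacian $\Delta$ (in particular lower semicontinuous, with value at each point at least its average over every sphere centered at that point). *)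

theory Defs
  imports "HOL-Probability.Probability"
begin

section \<open>Function spaces\<close>

definition L_alpha :: "real \<Rightarrow> ('a::euclidean_space \<Rightarrow> real) set" where
  "L_alpha \<alpha> =
     {u \<in> borel_measurable borel.
        integrable lborel (\<lambda>y. \<bar>u y\<bar> / (1 + norm y) powr (real DIM('a) + \<alpha>))}"

definition L_infinity_loc :: "('a::euclidean_space \<Rightarrow> real) set" where
  "L_infinity_loc =
     {u \<in> borel_measurable borel.
        \<forall>K. compact K \<longrightarrow> (\<exists>C. AE y in lborel. y \<in> K \<longrightarrow> \<bar>u y\<bar> \<le> C)}"

definition locally_integrable :: "('a::euclidean_space \<Rightarrow> real) \<Rightarrow> bool" where
  "locally_integrable u \<longleftrightarrow> (\<forall>K. compact K \<longrightarrow> set_integrable lborel K u)"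


section \<open>Classical superharmonic functions\<close>

text \<open>
  The normalized surface measure on the unit sphere, obtained from polar coordinates: it is the
  image of the uniform distribution on the unit ball under the radial projection
  \<open>y \<mapsto> y / |y|\<close>.
\<close>

definition unit_sphere_measure :: "'a::euclidean_space measure" where
  "unit_sphere_measure = distr (uniform_measure lborel (ball 0 1)) borel sgn"

definition lower_semicontinuous :: "('a::topological_space \<Rightarrow> real) \<Rightarrow> bool" where
  "lower_semicontinuous u \<longleftrightarrow> (\<forall>c. open {x. c < u x})"

text \<open>
  A lower semicontinuous function is bounded below on every sphere, so its average there always
  exists in \<open>(-\<infinity>, \<infinity>]\<close>.  Since \<open>u\<close> is real-valued, the inequality
  ``average at most \<open>u x\<close>'' forces the average to be finite; integrability is therefore stated
  explicitly, because the integral of a non-integrable function is zero by convention.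
\<close>

definition superharmonic :: "('a::euclidean_space \<Rightarrow> real) \<Rightarrow> bool" where
  "superharmonic u \<longleftrightarrow>
     lower_semicontinuous u \<and>
     (\<forall>x r. 0 < r \<longrightarrow>
        integrable unit_sphere_measure (\<lambda>y. u (x + r *\<^sub>R y)) \<and>
        (LINT y|unit_sphere_measure. u (x + r *\<^sub>R y)) \<le> u x)"


section \<open>The rotation invariant stable process\<close>

definition cadlag :: "(real \<Rightarrow> 'a::topological_space) \<Rightarrow> bool" where
  "cadlag p \<longleftrightarrow>
     (\<forall>t\<ge>0. (p \<longlongrightarrow> p t) (at_right t)) \<and>
     (\<forall>t>0. \<exists>l. (p \<longlongrightarrow> l) (at_left t))"

text \<open>
  A Levy process started at the origin with the characteristic function of the standard rotation
  invariant \<open>\<alpha>\<close>-stable process.  Only times \<open>t \<ge> 0\<close> are meaningful.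
\<close>

definition stable_process ::
  "real \<Rightarrow> 'w measure \<Rightarrow> (real \<Rightarrow> 'w \<Rightarrow> 'a::euclidean_space) \<Rightarrow> bool" where
  "stable_process \<alpha> M X \<longleftrightarrow>
     prob_space M \<and>
     (\<forall>t\<ge>0. X t \<in> borel_measurable M) \<and>
     (AE \<omega> in M. X 0 \<omega> = 0) \<and>
     (AE \<omega> in M. cadlag (\<lambda>t. X t \<omega>)) \<and>
     (\<forall>(t :: nat \<Rightarrow> real) n. 0 \<le> t 0 \<and> mono t \<longrightarrow>
        prob_space.indep_vars M (\<lambda>_. borel) (\<lambda>i \<omega>. X (t (Suc i)) \<omega> - X (t i) \<omega>) {..<n}) \<and>
     (\<forall>s\<ge>0. \<forall>t\<ge>0. distr M borel (\<lambda>\<omega>. X (s + t) \<omega> - X s \<omega>) = distr M borel (X t)) \<and>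
     (\<forall>t\<ge>0. \<forall>\<xi>. (CLINT \<omega>|M. iexp (\<xi> \<bullet> X t \<omega>)) = complex_of_real (exp (- t * norm \<xi> powr \<alpha>)))"

definition exit_time :: "'a set \<Rightarrow> (real \<Rightarrow> 'a) \<Rightarrow> ereal" where
  "exit_time U p = Inf {ereal t |t. t > 0 \<and> p t \<notin> U}"

text \<open>
  The value of \<open>u\<close> at the exit position.  If the path never leaves \<open>U\<close>, the value is 0; for
  bounded \<open>U\<close> this concerns only a null set of paths of the stable process.
\<close>

definition exit_value :: "('a \<Rightarrow> real) \<Rightarrow> 'a set \<Rightarrow> (real \<Rightarrow> 'a) \<Rightarrow> real" where
  "exit_value u U p =
     (if exit_time U p = \<infinity> then 0 else u (p (real_of_ereal (exit_time U p))))"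

text \<open>
  By spatial homogeneity the process started at \<open>x\<close> is \<open>x + X\<close>.  Exit times of cadlag paths are in
  general measurable only up to null sets, so expectations are taken with respect to the completed
  probability measure.
\<close>

definition alpha_superharmonic ::
  "'w measure \<Rightarrow> (real \<Rightarrow> 'w \<Rightarrow> 'a::euclidean_space) \<Rightarrow> ('a \<Rightarrow> real) \<Rightarrow> bool" where
  "alpha_superharmonic M X u \<longleftrightarrow>
     u \<in> borel_measurable borel \<and> locally_integrable u \<and>
     (\<forall>U. open U \<and> bounded U \<longrightarrow> (\<forall>x\<in>U.
        integrable (completion M) (\<lambda>\<omega>. exit_value u U (\<lambda>t. x + X t \<omega>)) \<and>
        (LINT \<omega>|completion M. exit_value u U (\<lambda>t. x + X t \<omega>)) \<le> u x))"

end

theory Submission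
  imports Defs
begin

text \<open>
  The law of \<open>X\<^sub>t\<close> is rotation invariant, so it is a mixture of uniform distributions on spheres
  around the origin.  A classically superharmonic \<open>u\<close> dominates its averages over spheres, and
  hence \<open>E[u(z + X\<^sub>t)] \<le> u(z)\<close> for all \<open>z\<close> and \<open>t\<close>
  (\<open>superharmonic_radial_law\<close>).  By independence of increments \<open>u(x + X\<^sub>t)\<close> is then a nonnegative
  supermartingale, and \<open>\<alpha>\<close>-superharmonicity is optional stopping at the exit time.  Nonnegativity
  and lower semicontinuity make Fatou's lemma available for every passage to the limit.

  The hypothesis on \<open>X\<^sub>t\<close> is that its characteristic function is radial.  To exploit it, add an
  independent small Gaussian: the density of the sum is a Gaussian average of the characteristic
  function, so it is visibly radial (\<open>gauss_smoothing_radial\<close>), and polar coordinates apply.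
  The Gaussian is removed by letting its variance tend to zero.

  Optional stopping is elementary for the first time on a dyadic grid at which the path lies in an
  open set \<open>G\<close> (\<open>grid_supermartingale\<close>).  Refining the grid, these times decrease to the
  hitting time of \<open>G\<close>, and right-continuity of the paths gives optional stopping there
  (\<open>hit_supermartingale\<close>).  The exit time from \<open>U\<close> is the hitting time of the closed set \<open>-U\<close>,
  which is not a countable infimum of this kind.  It is approximated from below by the hitting times
  of the open neighbourhoods of \<open>-U\<close> of radius \<open>1/n\<close>.  For these the
  positions converge to the position at the limit time because the process does not jump at a limit
  of increasing hitting times (\<open>quasi_left_continuous\<close>).  As \<open>-U\<close> is closed, the limit
  position lies outside \<open>U\<close>, so that the limit time is the exit time almost surely
  (\<open>exit_by_hitting\<close>).  This also shows that the exit position is measurable up to a null set.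
\<close>

section \<open>Rotation invariance of Lebesgue measure\<close>

lemma nn_integral_lborel_translate:
  fixes f :: "'a::euclidean_space \<Rightarrow> ennreal"
  assumes [measurable]: "f \<in> borel_measurable borel"
  shows "(\<integral>\<^sup>+x. f (t + x) \<partial>lborel) = (\<integral>\<^sup>+x. f x \<partial>lborel)"
  by (subst (2) lborel_distr_plus[of t, symmetric]) (simp add: nn_integral_distr)

lemma borel_measurable_orthogonal_transformation:
  fixes T :: "'a::euclidean_space \<Rightarrow> 'a"
  assumes "orthogonal_transformation T"
  shows "T \<in> borel_measurable borel"
  using assms unfolding orthogonal_transformation_def
  by (intro borel_measurable_continuous_onI linear_continuous_on) (auto simp: linear_conv_bounded_linear)

lemma emeasure_unit_ball:
  "emeasure lborel (ball 0 1 :: 'a::euclidean_space set) \<noteq> 0"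
  "emeasure lborel (ball 0 1 :: 'a::euclidean_space set) \<noteq> \<infinity>"
proof -
  show "emeasure lborel (ball 0 1 :: 'a set) \<noteq> 0"
    using open_not_negligible[of "ball 0 1 :: 'a set"] by (auto simp: negligible_iff_null_sets null_sets_def)
  show "emeasure lborel (ball 0 1 :: 'a set) \<noteq> \<infinity>"
    using emeasure_lborel_ball_finite[of "0::'a" 1] by simp
qed

text \<open>
  Translation invariance determines Lebesgue measure up to a factor: evaluate
  \<open>\<integral>\<integral> f(Tx + y) 1\<^sub>B(y) dy dx\<close> for the unit ball \<open>B\<close> in both orders.  Integrating over \<open>x\<close> first removes the shift
  \<open>y\<close> and leaves \<open>|B| \<integral> f(Tx) dx\<close>.  Substituting \<open>y - Tx\<close> for \<open>y\<close> leaves \<open>|B| \<integral> f\<close>, because \<open>T\<close>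
  maps balls to balls of the same radius.
\<close>

lemma nn_integral_lborel_orthogonal:
  fixes T :: "'a::euclidean_space \<Rightarrow> 'a" and f :: "'a \<Rightarrow> ennreal"
  assumes T: "orthogonal_transformation T" and f[measurable]: "f \<in> borel_measurable borel"
  shows "(\<integral>\<^sup>+x. f (T x) \<partial>lborel) = (\<integral>\<^sup>+x. f x \<partial>lborel)"
proof -
  have lin: "linear T" and iso: "norm (T v) = norm v" for v
    using T by (auto simp: orthogonal_transformation)
  have inj: "inj T"
    using iso lin by (metis linear_injective_0 norm_eq_zero)
  then have surj: "surj T"
    using lin linear_inj_imp_surj by blast
  note [measurable] = borel_measurable_orthogonal_transformation[OF T]
  let ?B = "ball 0 1 :: 'a set"
  have [measurable]: "?B \<in> sets borel" by simp
  have shift: "(\<integral>\<^sup>+x. f (T x + y) \<partial>lborel) = (\<integral>\<^sup>+x. f (T x) \<partial>lborel)" for y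
  proof -
    obtain z where z: "y = T z" using surj by auto
    have "(\<integral>\<^sup>+x. f (T x + y) \<partial>lborel) = (\<integral>\<^sup>+x. f (T (z + x)) \<partial>lborel)"
      using lin by (simp add: z linear_add add.commute)
    also have "\<dots> = (\<integral>\<^sup>+x. f (T x) \<partial>lborel)"
      by (rule nn_integral_lborel_translate) measurable
    finally show ?thesis .
  qed
  have ball: "(\<integral>\<^sup>+x. indicator ?B (y - T x) \<partial>lborel) = emeasure lborel ?B" for y
  proof -
    obtain z where z: "y = T z" using surj by auto
    have "(\<integral>\<^sup>+x. indicator ?B (y - T x) \<partial>lborel) = (\<integral>\<^sup>+x. indicator ?B (- z + x) \<partial>lborel)"
    proof (rule nn_integral_cong)
      fix x
      have "y - T x = T (z - x)" using lin by (simp add: z linear_diff)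
      then have "norm (y - T x) = norm (- z + x)"
        by (simp add: iso norm_minus_commute)
      then show "(indicator ?B (y - T x) :: ennreal) = indicator ?B (- z + x)"
        by (simp add: indicator_def)
    qed
    also have "\<dots> = (\<integral>\<^sup>+x. indicator ?B x \<partial>lborel)"
      by (rule nn_integral_lborel_translate) measurable
    finally show ?thesis by simp
  qed
  have "(\<integral>\<^sup>+x. f (T x) \<partial>lborel) * emeasure lborel ?B
      = (\<integral>\<^sup>+y. (\<integral>\<^sup>+x. f (T x + y) \<partial>lborel) * indicator ?B y \<partial>lborel)"
    by (simp add: shift nn_integral_cmult)
  also have "\<dots> = (\<integral>\<^sup>+y. (\<integral>\<^sup>+x. f (T x + y) * indicator ?B y \<partial>lborel) \<partial>lborel)"
    by (intro nn_integral_cong nn_integral_multc[symmetric]) measurable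
  also have "\<dots> = (\<integral>\<^sup>+x. (\<integral>\<^sup>+y. f (T x + y) * indicator ?B y \<partial>lborel) \<partial>lborel)"
    by (intro lborel_pair.Fubini') measurable
  also have "\<dots> = (\<integral>\<^sup>+x. (\<integral>\<^sup>+y. f y * indicator ?B (y - T x) \<partial>lborel) \<partial>lborel)"
  proof (rule nn_integral_cong)
    fix x
    show "(\<integral>\<^sup>+y. f (T x + y) * indicator ?B y \<partial>lborel)
        = (\<integral>\<^sup>+y. f y * indicator ?B (y - T x) \<partial>lborel)"
      using nn_integral_lborel_translate[of "\<lambda>y. f y * indicator ?B (y - T x)" "T x"] by simp
  qed
  also have "\<dots> = (\<integral>\<^sup>+y. (\<integral>\<^sup>+x. f y * indicator ?B (y - T x) \<partial>lborel) \<partial>lborel)"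
    by (intro lborel_pair.Fubini') measurable
  also have "\<dots> = (\<integral>\<^sup>+y. f y * emeasure lborel ?B \<partial>lborel)"
    by (intro nn_integral_cong) (simp add: nn_integral_cmult ball)
  also have "\<dots> = (\<integral>\<^sup>+y. f y \<partial>lborel) * emeasure lborel ?B"
    by (simp add: nn_integral_multc)
  finally have "(\<integral>\<^sup>+x. f (T x) \<partial>lborel) * emeasure lborel ?B = (\<integral>\<^sup>+y. f y \<partial>lborel) * emeasure lborel ?B" .
  then show ?thesis
    using emeasure_unit_ball[where 'a = 'a] ennreal_mult_cancel_left[of "emeasure lborel ?B"] by (metis infinity_ennreal_def mult.commute)
qed

section \<open>Polar coordinates\<close>

lemma prob_space_unit_sphere_measure: "prob_space (unit_sphere_measure :: 'a::euclidean_space measure)"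
proof -
  interpret prob_space "uniform_measure lborel (ball 0 1 :: 'a set)"
    using emeasure_unit_ball by (rule prob_space_uniform_measure)
  show ?thesis unfolding unit_sphere_measure_def
    by (rule prob_space_distr) measurable
qed

lemma space_unit_sphere_measure [simp]: "space unit_sphere_measure = UNIV"
  and sets_unit_sphere_measure [simp, measurable_cong]: "sets unit_sphere_measure = sets borel"
  by (simp_all add: unit_sphere_measure_def)

text \<open>
  A cone truncated at radius \<open>r\<close> is the dilation by \<open>r\<close> of the one truncated at radius \<open>1\<close>.
\<close>

lemma emeasure_sector:
  fixes A :: "'a::euclidean_space set"
  assumes [measurable]: "A \<in> sets borel" and "r \<ge> 0"
  shows "emeasure lborel {z. norm z \<le> r \<and> sgn z \<in> A} = 
         ennreal (r ^ DIM('a)) * emeasure lborel {z. norm z \<le> 1 \<and> sgn z \<in> A}"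
proof (cases "r = 0")
  case True
  have "emeasure lborel {z. norm z \<le> r \<and> sgn z \<in> A} \<le> emeasure lborel {0::'a}"
    by (rule emeasure_mono) (auto simp: True)
  then show ?thesis by (simp add: True)
next
  case False
  with assms have r: "r > 0" by simp
  have sgn: "sgn (r *\<^sub>R z) = sgn z" for z :: 'a
    using r by (simp add: sgn_scaleR)
  have "emeasure lborel {z. norm z \<le> r \<and> sgn z \<in> A}
      = emeasure (density (distr lborel borel (\<lambda>x. 0 + r *\<^sub>R x)) (\<lambda>_. \<bar>r\<bar> ^ DIM('a))) {z. norm z \<le> r \<and> sgn z \<in> A}"
    using r by (subst lborel_affine[of r 0]) auto
  also have "\<dots> = ennreal (r ^ DIM('a)) * emeasure lborel {z. norm (r *\<^sub>R z) \<le> r \<and> sgn (r *\<^sub>R z) \<in> A}"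
    using r by (simp add: emeasure_density nn_integral_cmult nn_integral_distr emeasure_distr ennreal_power vimage_def)
  also have "{z. norm (r *\<^sub>R z) \<le> r \<and> sgn (r *\<^sub>R z) \<in> A} = {z. norm z \<le> 1 \<and> sgn z \<in> A}"
    using r by (auto simp: sgn)
  finally show ?thesis .
qed

lemma emeasure_unit_sphere_measure:
  fixes A :: "'a::euclidean_space set"
  assumes [measurable]: "A \<in> sets borel"
  shows "emeasure unit_sphere_measure A * emeasure lborel (cball 0 1 :: 'a set)
       = emeasure lborel {z. norm z \<le> 1 \<and> sgn z \<in> A}"
proof -
  have m[measurable]: "sgn -` A \<in> sets (borel :: 'a measure)"
    using measurable_sets[of sgn borel borel A] by simp
  let ?B = "ball 0 1 :: 'a set"
  have nz: "emeasure lborel ?B \<noteq> 0" and fin: "emeasure lborel ?B \<noteq> \<infinity>"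
    using emeasure_unit_ball[where 'a = 'a] by auto
  \<comment> \<open>The definition uses the open ball, the polar decomposition the closed one.\<close>
  have "negligible (sphere (0::'a) 1)" by (rule negligible_sphere)
  then have "sphere (0::'a) 1 \<in> null_sets lborel"
    by (auto simp: negligible_iff_null_sets null_sets_def)
  then have ae: "AE z in lborel. norm (z::'a) \<noteq> 1"
    by (rule AE_I') auto
  have c: "emeasure lborel (cball 0 1 :: 'a set) = emeasure lborel ?B"
    by (rule emeasure_eq_AE) (use ae in \<open>auto elim!: eventually_mono\<close>)
  have s: "emeasure lborel {z::'a. norm z \<le> 1 \<and> sgn z \<in> A} = emeasure lborel (?B \<inter> (sgn -` A))"
    by (rule emeasure_eq_AE) (use ae m in \<open>auto elim!: eventually_mono\<close>)
  have "emeasure unit_sphere_measure A = emeasure lborel (?B \<inter> (sgn -` A)) / emeasure lborel ?B"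
    unfolding unit_sphere_measure_def using m by (simp add: emeasure_distr)
  moreover have "emeasure lborel ?B < top" using fin by (simp add: less_top)
  ultimately show ?thesis using nz unfolding c s
    by (metis ennreal_divide_times ennreal_divide_self mult.right_neutral)
qed

text \<open>
  The radius and the direction of a Lebesgue point are independent: by homogeneity the volume of
  a truncated cone splits into a function of the radius and a function of the directions, and the
  intervals \<open>{..r}\<close> generate the Borel sets of the line.
\<close>

lemma lborel_polar:
  "distr lborel borel (norm :: 'a \<Rightarrow> real) \<Otimes>\<^sub>M (unit_sphere_measure :: 'a::euclidean_space measure)
     = distr lborel (borel \<Otimes>\<^sub>M borel) (\<lambda>z::'a. (norm z, sgn z))"
proof (rule pair_measure_eqI)
  interpret S: prob_space "unit_sphere_measure :: 'a measure" by (rule prob_space_unit_sphere_measure)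
  show "sigma_finite_measure (unit_sphere_measure :: 'a measure)" by unfold_locales
  have vm: "norm -` {.. r} = (cball 0 r :: 'a set)" for r by auto
  have finB: "emeasure (distr lborel borel (norm :: 'a \<Rightarrow> real)) {..r} \<noteq> \<infinity>" for r
    using emeasure_lborel_cball_finite[of "0::'a" r] by (simp add: emeasure_distr vm)
  show "sigma_finite_measure (distr lborel borel (norm :: 'a \<Rightarrow> real))"
  proof
    show "\<exists>A. countable A \<and> A \<subseteq> sets (distr lborel borel (norm :: 'a \<Rightarrow> real)) \<and> \<Union>A = space (distr lborel borel (norm :: 'a \<Rightarrow> real)) \<and>
      (\<forall>a\<in>A. emeasure (distr lborel borel (norm :: 'a \<Rightarrow> real)) a \<noteq> \<infinity>)"
      by (rule exI[of _ "range (\<lambda>n::nat. {..real n})"])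
         (use finB in \<open>auto simp: real_arch_simple\<close>)
  qed
  show "sets (distr lborel borel (norm :: 'a \<Rightarrow> real) \<Otimes>\<^sub>M (unit_sphere_measure :: 'a measure))
    = sets (distr lborel (borel \<Otimes>\<^sub>M borel) (\<lambda>z::'a. (norm z, sgn z)))"
    by (simp cong: sets_pair_measure_cong)
  fix A :: "real set" and B :: "'a set"
  assume "A \<in> sets (distr lborel borel (norm :: 'a \<Rightarrow> real))" "B \<in> sets unit_sphere_measure"
  then have A[measurable]: "A \<in> sets borel" and B[measurable]: "B \<in> sets borel" by auto
  have sB[measurable]: "sgn -` B \<in> sets (borel :: 'a measure)"
    using measurable_sets[of sgn borel borel B] by simp
  let ?b = "emeasure unit_sphere_measure B"
  \<comment> \<open>For a fixed set of directions, both sides are measures in the radial set \<open>A\<close>.\<close>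
  define M1 where "M1 = scale_measure ?b (distr lborel borel (norm :: 'a \<Rightarrow> real))"
  define M2 where "M2 = distr (density lborel (indicator (sgn -` B :: 'a set))) borel (norm :: 'a \<Rightarrow> real)"
  have M2: "emeasure M2 X = emeasure lborel {z. norm z \<in> X \<and> sgn z \<in> B}" if [measurable]: "X \<in> sets borel" for X
  proof -
    have "norm -` X \<in> sets (borel :: 'a measure)"
      using measurable_sets[of norm borel borel X] by simp
    then have "emeasure M2 X = (\<integral>\<^sup>+z. indicator (sgn -` B) z * indicator (norm -` X) z \<partial>lborel)"
      unfolding M2_def by (simp add: emeasure_distr emeasure_density)
    also have "\<dots> = (\<integral>\<^sup>+z. indicator {z. norm z \<in> X \<and> sgn z \<in> B} z \<partial>lborel)"
      by (intro nn_integral_cong) (auto simp: indicator_def)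
    finally show ?thesis by simp
  qed
  have "M1 = M2"
  proof (rule measure_eqI_generator_eq[where E = "range (\<lambda>r::real. {..r})" and \<Omega> = UNIV and A = "\<lambda>n. {..real n}"])
    show "Int_stable (range (\<lambda>r::real. {..r}))"
      by (auto simp: Int_stable_def intro!: image_eqI[where x = "min _ _"])
    show "sets M1 = sigma_sets UNIV (range (\<lambda>r::real. {..r}))"
      "sets M2 = sigma_sets UNIV (range (\<lambda>r::real. {..r}))"
      by (simp_all add: M1_def M2_def borel_eq_atMost)
    show "(\<Union>n. {..real n}) = (UNIV :: real set)" by (auto simp: real_arch_simple)
    show "emeasure M1 {..real n} \<noteq> \<infinity>" for n
      using finB[of "real n"] by (simp add: M1_def ennreal_mult_eq_top_iff S.emeasure_eq_measure)
    fix X assume "X \<in> range (\<lambda>r::real. {..r})"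
    then obtain r where X: "X = {..r}" by auto
    have M1: "emeasure M1 X = ?b * emeasure lborel (cball (0::'a) r)"
      by (simp add: M1_def X emeasure_distr vm)
    show "emeasure M1 X = emeasure M2 X"
    proof (cases "r \<ge> 0")
      case True
      have "emeasure lborel (cball (0::'a) r) = ennreal (r ^ DIM('a)) * emeasure lborel (cball (0::'a) 1)"
        using emeasure_sector[of "UNIV :: 'a set" r] True by (simp add: cball_def)
      then have "emeasure M1 X = ennreal (r ^ DIM('a)) * (?b * emeasure lborel (cball (0::'a) 1))"
        unfolding M1 by (simp only: ac_simps)
      also have "\<dots> = emeasure M2 X"
        using emeasure_sector[OF B True] by (simp add: emeasure_unit_sphere_measure M2 X)
      finally show ?thesis .
    next
      case False
      have "\<not> norm z \<le> r" for z :: 'a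
        using False norm_ge_zero[of z] by linarith
      then have e: "{z::'a. norm z \<in> {..r} \<and> sgn z \<in> B} = {}" and e': "cball (0::'a) r = {}"
        using False by auto
      have "emeasure M2 X = 0"
        unfolding X by (subst M2) (simp_all only: e emeasure_empty, simp)
      moreover have "emeasure M1 X = 0"
        unfolding M1 e' by simp
      ultimately show ?thesis by simp
    qed
  qed auto
  then have "emeasure M1 A = emeasure M2 A" by simp
  then show "emeasure (distr lborel borel (norm :: 'a \<Rightarrow> real)) A * ?b =
      emeasure (distr lborel (borel \<Otimes>\<^sub>M borel) (\<lambda>z::'a. (norm z, sgn z))) (A \<times> B)"
    by (simp add: M2) (simp add: M1_def emeasure_distr mult.commute vimage_def)
qed

lemma nn_integral_polar:
  fixes w :: "'a::euclidean_space \<Rightarrow> ennreal"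
  assumes [measurable]: "w \<in> borel_measurable borel"
  shows "(\<integral>\<^sup>+z. w z \<partial>lborel) = (\<integral>\<^sup>+r. (\<integral>\<^sup>+y. w (r *\<^sub>R y) \<partial>unit_sphere_measure) \<partial>distr lborel borel (norm :: 'a \<Rightarrow> real))"
proof -
  interpret S: prob_space "unit_sphere_measure :: 'a measure" by (rule prob_space_unit_sphere_measure)
  have "norm z *\<^sub>R sgn z = z" for z :: 'a
    by (cases "z = 0") (simp_all add: sgn_div_norm)
  then have "(\<integral>\<^sup>+z. w z \<partial>lborel) = (\<integral>\<^sup>+z. w (norm z *\<^sub>R sgn z) \<partial>lborel)"
    by simp
  also have "\<dots> = (\<integral>\<^sup>+p. w (fst p *\<^sub>R snd p) \<partial>distr lborel (borel \<Otimes>\<^sub>M borel) (\<lambda>z::'a. (norm z, sgn z)))"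
    by (simp add: nn_integral_distr)
  also have "\<dots> = (\<integral>\<^sup>+p. w (fst p *\<^sub>R snd p) \<partial>(distr lborel borel (norm :: 'a \<Rightarrow> real) \<Otimes>\<^sub>M unit_sphere_measure))"
    by (simp add: lborel_polar)
  also have "\<dots> = (\<integral>\<^sup>+r. (\<integral>\<^sup>+y. w (r *\<^sub>R y) \<partial>unit_sphere_measure) \<partial>distr lborel borel (norm :: 'a \<Rightarrow> real))"
    by (subst S.nn_integral_fst[symmetric]) (simp_all cong: measurable_cong_sets sets_pair_measure_cong)
  finally show ?thesis .
qed


section \<open>The standard Gaussian measure\<close>

definition gauss_density :: "'a::euclidean_space \<Rightarrow> real" where
  "gauss_density x = (\<Prod>b\<in>Basis. std_normal_density (x \<bullet> b))"

abbreviation gauss :: "'a::euclidean_space measure" where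
  "gauss \<equiv> density lborel (\<lambda>x. ennreal (gauss_density x))"

lemma gauss_density_measurable [measurable]: "gauss_density \<in> borel_measurable borel"
  unfolding gauss_density_def[abs_def] by measurable

lemma gauss_density_nonneg: "0 \<le> gauss_density x"
  unfolding gauss_density_def by (intro prod_nonneg) auto

lemma exp_norm_squared:
  "exp (- (norm (x :: 'a::euclidean_space))\<^sup>2 / 2) = (\<Prod>b\<in>Basis. exp (- (x \<bullet> b)\<^sup>2 / 2))"
proof -
  have "(norm x)\<^sup>2 = (\<Sum>b\<in>Basis. (x \<bullet> b)\<^sup>2)"
    unfolding norm_eq_sqrt_inner by (subst euclidean_inner) (simp add: sum_nonneg power2_eq_square)
  then show ?thesis
    by (simp add: exp_sum[symmetric] sum_negf sum_divide_distrib)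
qed

lemma gauss_density_eq:
  "gauss_density (x :: 'a::euclidean_space) = (1 / sqrt (2 * pi)) ^ DIM('a) * exp (- (norm x)\<^sup>2 / 2)"
  unfolding gauss_density_def std_normal_density_def prod.distrib exp_norm_squared by simp

lemma prob_space_gauss: "prob_space (gauss :: 'a::euclidean_space measure)"
proof
  have n: "(\<integral>\<^sup>+x. ennreal (std_normal_density x) \<partial>lborel) = 1"
    using prob_space.emeasure_space_1[OF prob_space_normal_density[of 1 0]]
    by (simp add: emeasure_density)
  have "(\<integral>\<^sup>+x. ennreal (gauss_density x) \<partial>(lborel :: 'a measure)) = 
     (\<integral>\<^sup>+x. (\<Prod>b\<in>Basis. ennreal (std_normal_density (x \<bullet> b))) \<partial>(lborel :: 'a measure))"
    unfolding gauss_density_def by (subst prod_ennreal) auto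
  also have "\<dots> = 1"
    by (subst nn_integral_lborel_prod) (simp_all add: n)
  finally show "emeasure gauss (space (gauss :: 'a measure)) = 1"
    by (simp add: emeasure_density)
qed

text \<open>
  Up to normalization the Gaussian density is its own Fourier transform.  The integral factorizes
  over the coordinates.
\<close>

lemma char_gauss:
  fixes v :: "'a::euclidean_space"
  shows "(CLINT x|gauss. iexp (x \<bullet> v)) = complex_of_real (exp (- (norm v)\<^sup>2 / 2))"
proof -
  interpret product_sigma_finite "\<lambda>_::'a. lborel :: real measure" ..
  define f where "f b x = of_real (std_normal_density x) * iexp (x * (v \<bullet> b))" for b x
  have intf: "integrable lborel (f b)" for b
  proof (rule Bochner_Integration.integrable_bound)
    show "integrable lborel std_normal_density"
      by (rule integrable_normal_density) simp
    show "f b \<in> borel_measurable lborel" unfolding f_def by measurable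
  qed (auto simp: f_def norm_mult)
  have ci: "integral\<^sup>L lborel (f b) = complex_of_real (exp (- (v \<bullet> b)\<^sup>2 / 2))" for b
  proof -
    have "char std_normal_distribution (v \<bullet> b) = (CLINT x|lborel. std_normal_density x *\<^sub>R iexp ((v \<bullet> b) * x))"
      unfolding char_def by (subst integral_density) auto
    also have "\<dots> = integral\<^sup>L lborel (f b)"
      unfolding f_def by (intro Bochner_Integration.integral_cong) (auto simp: scaleR_conv_of_real mult.commute)
    finally show ?thesis by (simp add: char_std_normal_distribution)
  qed
  have "(CLINT x|gauss. iexp (x \<bullet> v)) = (CLINT x|lborel. gauss_density x *\<^sub>R iexp (x \<bullet> v))"
    by (subst integral_density) (auto simp: gauss_density_nonneg)
  also have "\<dots> = (CLINT x|lborel. (\<Prod>b\<in>Basis. f b (x \<bullet> b)))"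
  proof (intro Bochner_Integration.integral_cong refl)
    fix x :: 'a
    have "iexp (x \<bullet> v) = (\<Prod>b\<in>Basis. iexp ((x \<bullet> b) * (v \<bullet> b)))"
      by (subst euclidean_inner) (simp add: exp_sum[symmetric] sum_distrib_left)
    then show "gauss_density x *\<^sub>R iexp (x \<bullet> v) = (\<Prod>b\<in>Basis. f b (x \<bullet> b))"
      by (simp add: f_def prod.distrib gauss_density_def scaleR_conv_of_real)
  qed
  also have "\<dots> = (CLINT p|(\<Pi>\<^sub>M b\<in>Basis. lborel). (\<Prod>b\<in>Basis. f b ((\<Sum>c\<in>Basis. p c *\<^sub>R c) \<bullet> b)))"
    by (subst lborel_eq, subst integral_distr) (auto simp: f_def)
  also have "\<dots> = (CLINT p|(\<Pi>\<^sub>M b\<in>Basis. lborel). (\<Prod>b\<in>Basis. f b (p b)))"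
    by (intro Bochner_Integration.integral_cong prod.cong refl) simp
  also have "\<dots> = (\<Prod>b\<in>Basis. integral\<^sup>L lborel (f b))"
    using intf by (intro product_integral_prod) auto
  also have "\<dots> = complex_of_real (\<Prod>b\<in>Basis. exp (- (v \<bullet> b)\<^sup>2 / 2))"
    by (simp add: ci)
  finally show ?thesis
    unfolding exp_norm_squared .
qed

lemma gauss_distr_orthogonal:
  fixes T :: "'a::euclidean_space \<Rightarrow> 'a"
  assumes T: "orthogonal_transformation T"
  shows "distr gauss borel T = gauss"
proof (rule measure_eqI)
  note [measurable] = borel_measurable_orthogonal_transformation[OF T]
  fix A assume "A \<in> sets (distr gauss borel T)"
  then have [measurable]: "A \<in> sets borel" by simp
  have "norm (T x) = norm x" for x
    using T by (simp add: orthogonal_transformation)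
  then have d: "gauss_density (T x) = gauss_density x" for x
    by (simp add: gauss_density_eq)
  have "T -` A \<in> sets borel"
    using measurable_sets[of T borel borel A] by simp
  then have "emeasure (distr gauss borel T) A = (\<integral>\<^sup>+x. ennreal (gauss_density (T x)) * indicator A (T x) \<partial>lborel)"
    by (simp add: emeasure_distr emeasure_density d) (intro nn_integral_cong, auto simp: indicator_def)
  also have "\<dots> = (\<integral>\<^sup>+x. ennreal (gauss_density x) * indicator A x \<partial>lborel)"
    by (rule nn_integral_lborel_orthogonal[OF T, of "\<lambda>x. ennreal (gauss_density x) * indicator A x"]) measurable
  also have "\<dots> = emeasure gauss A" by (simp add: emeasure_density)
  finally show "emeasure (distr gauss borel T) A = emeasure gauss A" .
qed simp

section \<open>Superharmonic functions and laws with radial characteristic function\<close>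

text \<open>
  The function is, up to a constant factor, the density at \<open>z\<close> of \<open>\<mu>\<close> convolved with a Gaussian of standard deviation
  \<open>1/s\<close>.  Writing the Gaussian as a Fourier integral and exchanging integrals turns it into
  \<open>\<integral> e\<^sup>i\<^sup>s\<^sup>x\<^sup>z q(|sx|) d\<gamma>(x)\<close> with \<open>\<gamma>\<close> the standard Gaussian measure, and \<open>\<gamma>\<close> is invariant under the
  rotation that takes \<open>z\<close> to \<open>z'\<close>.
\<close>

lemma gauss_smoothing_radial:
  fixes \<mu> :: "(real ^ 'n) measure" and q :: "real \<Rightarrow> complex"
  assumes "prob_space \<mu>" and sets [measurable_cong]: "sets \<mu> = sets borel"
    and q: "\<And>\<xi>. (CLINT y|\<mu>. iexp (\<xi> \<bullet> y)) = q (norm \<xi>)"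
    and norm: "norm z = norm z'"
  shows "(LINT y|\<mu>. exp (- (norm (s *\<^sub>R (z - y)))\<^sup>2 / 2)) = (LINT y|\<mu>. exp (- (norm (s *\<^sub>R (z' - y)))\<^sup>2 / 2))"
proof -
  interpret \<mu>: prob_space \<mu> by fact
  interpret g: prob_space "gauss :: (real ^ 'n) measure" by (rule prob_space_gauss)
  interpret P: pair_prob_space \<mu> "gauss :: (real ^ 'n) measure" ..
  have eq: "complex_of_real (LINT y|\<mu>. exp (- (norm (s *\<^sub>R (z - y)))\<^sup>2 / 2)) = 
     (CLINT x|gauss. iexp (x \<bullet> (s *\<^sub>R z)) * q (norm (s *\<^sub>R x)))" for z
  proof -
    have "complex_of_real (LINT y|\<mu>. exp (- (norm (s *\<^sub>R (z - y)))\<^sup>2 / 2)) = 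
       (CLINT y|\<mu>. complex_of_real (exp (- (norm (s *\<^sub>R (z - y)))\<^sup>2 / 2)))"
      by simp
    also have "\<dots> = (CLINT y|\<mu>. (CLINT x|gauss. iexp (x \<bullet> (s *\<^sub>R (z - y)))))"
      by (simp only: char_gauss)
    also have "\<dots> = (CLINT x|gauss. (CLINT y|\<mu>. iexp (x \<bullet> (s *\<^sub>R (z - y)))))"
      by (rule P.Fubini_integral[symmetric], rule P.integrable_const_bound[where B = 1]) auto
    also have "\<dots> = (CLINT x|gauss. iexp (x \<bullet> (s *\<^sub>R z)) * q (norm (s *\<^sub>R x)))"
    proof (intro Bochner_Integration.integral_cong refl)
      fix x :: "real ^ 'n"
      have "x \<bullet> (s *\<^sub>R (z - y)) = x \<bullet> (s *\<^sub>R z) + (- s *\<^sub>R x) \<bullet> y" for y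
        by (simp add: inner_diff_right right_diff_distrib)
      then have "iexp (x \<bullet> (s *\<^sub>R (z - y))) = iexp (x \<bullet> (s *\<^sub>R z)) * iexp ((- s *\<^sub>R x) \<bullet> y)" for y
        by (simp only: of_real_add distrib_left exp_add)
      then have "(CLINT y|\<mu>. iexp (x \<bullet> (s *\<^sub>R (z - y)))) = 
        iexp (x \<bullet> (s *\<^sub>R z)) * (CLINT y|\<mu>. iexp ((- s *\<^sub>R x) \<bullet> y))"
        by (simp only: integral_mult_right_zero)
      also have "\<dots> = iexp (x \<bullet> (s *\<^sub>R z)) * q (norm (s *\<^sub>R x))"
        by (simp only: q) simp
      finally show "(CLINT y|\<mu>. iexp (x \<bullet> (s *\<^sub>R (z - y)))) = iexp (x \<bullet> (s *\<^sub>R z)) * q (norm (s *\<^sub>R x))" .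
    qed
    finally show ?thesis .
  qed
  obtain T where T: "orthogonal_transformation T" and Tz: "T z = z'"
    using orthogonal_transformation_exists[OF norm] by blast
  have Tn: "norm (T x) = norm x" for x using T by (simp add: orthogonal_transformation)
  have Ti: "T x \<bullet> T y = x \<bullet> y" for x y using T by (simp add: orthogonal_transformation_def)
  note [measurable] = borel_measurable_orthogonal_transformation[OF T]
  have qm: "(\<lambda>x. q (norm (s *\<^sub>R x))) \<in> borel_measurable (borel :: (real ^ 'n) measure)"
  proof -
    have "(\<lambda>x. CLINT y|\<mu>. iexp ((s *\<^sub>R x) \<bullet> y)) \<in> borel_measurable (borel :: (real ^ 'n) measure)"
      by measurable
    then show ?thesis unfolding q .
  qed
  have "(CLINT x|gauss. iexp (x \<bullet> (s *\<^sub>R z')) * q (norm (s *\<^sub>R x))) = 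
     (CLINT x|distr gauss borel T. iexp (x \<bullet> (s *\<^sub>R z')) * q (norm (s *\<^sub>R x)))"
    by (simp only: gauss_distr_orthogonal[OF T])
  also have "\<dots> = (CLINT x|gauss. iexp (T x \<bullet> (s *\<^sub>R z')) * q (norm (s *\<^sub>R T x)))"
    using qm by (subst integral_distr) auto
  also have "\<dots> = (CLINT x|gauss. iexp (x \<bullet> (s *\<^sub>R z)) * q (norm (s *\<^sub>R x)))"
    by (simp only: Tz[symmetric] Ti Tn norm_scaleR inner_scaleR_right)
  finally show ?thesis unfolding eq[symmetric] by (simp only: of_real_eq_iff)
qed

lemma lower_semicontinuous_measurable:
  fixes u :: "'a::euclidean_space \<Rightarrow> real"
  assumes "lower_semicontinuous u"
  shows "u \<in> borel_measurable borel"
  using assms unfolding lower_semicontinuous_def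
  by (intro borel_measurable_iff_greater[THEN iffD2]) (auto intro: borel_open)

text \<open>
  The form in which lower semicontinuity meets Fatou's lemma.
\<close>

lemma lower_semicontinuous_le_liminf:
  fixes u :: "'a::topological_space \<Rightarrow> real" and z :: "nat \<Rightarrow> 'a"
  assumes u: "lower_semicontinuous u" and z: "z \<longlonglongrightarrow> l"
  shows "ennreal (u l) \<le> liminf (\<lambda>n. ennreal (u (z n)))"
proof (rule le_Liminf_iff[THEN iffD2], intro allI impI)
  fix y assume y: "y < ennreal (u l)"
  then obtain c where c: "y = ennreal c" "0 \<le> c" "c < u l"
    by (cases y) (auto simp: ennreal_less_iff)
  have "\<forall>\<^sub>F n in sequentially. z n \<in> {x. c < u x}"
    using u c by (intro topological_tendstoD[OF z]) (auto simp: lower_semicontinuous_def)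
  then show "\<forall>\<^sub>F n in sequentially. y < ennreal (u (z n))"
    by eventually_elim (use c in \<open>auto simp: ennreal_less_iff\<close>)
qed

text \<open>
  Integrate the spherical mean inequality over the radius.
\<close>

lemma superharmonic_radial_weight:
  fixes u k :: "'a::euclidean_space \<Rightarrow> real"
  assumes u: "superharmonic u" "\<And>x. u x \<ge> 0"
    and k[measurable]: "k \<in> borel_measurable borel" and k0: "\<And>z. k z \<ge> 0"
    and radial: "\<And>z z'. norm z = norm z' \<Longrightarrow> k z = k z'"
  shows "(\<integral>\<^sup>+z. ennreal (u (x + z)) * ennreal (k z) \<partial>lborel) \<le> ennreal (u x) * (\<integral>\<^sup>+z. ennreal (k z) \<partial>lborel)"
proof -
  interpret S: prob_space "unit_sphere_measure :: 'a measure" by (rule prob_space_unit_sphere_measure)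
  have [measurable]: "u \<in> borel_measurable borel"
    using u by (intro lower_semicontinuous_measurable) (auto simp: superharmonic_def)
  obtain b :: 'a where b: "b \<in> Basis" by (meson nonempty_Basis ex_in_conv)
  define K where "K r = k (r *\<^sub>R b)" for r
  have [measurable]: "K \<in> borel_measurable borel" unfolding K_def[abs_def] by measurable
  have kK: "k z = K (norm z)" for z
    unfolding K_def using b by (intro radial) simp
  \<comment> \<open>The origin is the only point of the ball whose radial projection is not on the sphere.\<close>
  have ae: "AE y in unit_sphere_measure. norm (y :: 'a) = 1"
    unfolding unit_sphere_measure_def
  proof (subst AE_distr_iff)
    show "AE y in uniform_measure lborel (ball 0 1). norm (sgn y :: 'a) = 1"
    proof (rule AE_uniform_measureI)
      show "AE y in lborel. (y :: 'a) \<in> ball 0 1 \<longrightarrow> norm (sgn y) = 1"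
        using AE_lborel_singleton[of "0 :: 'a"] by eventually_elim (auto simp: norm_sgn)
    qed simp
  qed measurable
  have sph: "(\<integral>\<^sup>+y. ennreal (u (x + r *\<^sub>R y)) \<partial>unit_sphere_measure) \<le> ennreal (u x)" if "r \<ge> 0" for r
  proof (cases "r = 0")
    case True
    then show ?thesis by (simp add: S.emeasure_space_1[simplified])
  next
    case False
    then have "integrable unit_sphere_measure (\<lambda>y. u (x + r *\<^sub>R y))"
      "(LINT y|unit_sphere_measure. u (x + r *\<^sub>R y)) \<le> u x"
      using u that unfolding superharmonic_def by auto
    then show ?thesis
      using u(2) by (subst nn_integral_eq_integral) (auto intro: ennreal_leI)
  qed
  let ?\<rho> = "distr lborel borel (norm :: 'a \<Rightarrow> real)"
  have "(\<integral>\<^sup>+z. ennreal (u (x + z)) * ennreal (k z) \<partial>lborel) = 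
    (\<integral>\<^sup>+r. (\<integral>\<^sup>+y. ennreal (u (x + r *\<^sub>R y)) * ennreal (k (r *\<^sub>R y)) \<partial>unit_sphere_measure) \<partial>?\<rho>)"
    by (rule nn_integral_polar) measurable
  also have "\<dots> \<le> (\<integral>\<^sup>+r. ennreal (u x) * ennreal (K r) \<partial>?\<rho>)"
  proof (rule nn_integral_mono_AE)
    have "AE r in ?\<rho>. r \<ge> 0" by (subst AE_distr_iff) auto
    then show "AE r in ?\<rho>. (\<integral>\<^sup>+y. ennreal (u (x + r *\<^sub>R y)) * ennreal (k (r *\<^sub>R y)) \<partial>unit_sphere_measure) \<le> ennreal (u x) * ennreal (K r)"
    proof eventually_elim
      case (elim r)
      have "(\<integral>\<^sup>+y. ennreal (u (x + r *\<^sub>R y)) * ennreal (k (r *\<^sub>R y)) \<partial>unit_sphere_measure)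
        = (\<integral>\<^sup>+y. ennreal (u (x + r *\<^sub>R y)) * ennreal (K r) \<partial>unit_sphere_measure)"
        by (rule nn_integral_cong_AE) (use ae elim in \<open>auto simp: kK elim!: eventually_mono\<close>)
      also have "\<dots> = (\<integral>\<^sup>+y. ennreal (u (x + r *\<^sub>R y)) \<partial>unit_sphere_measure) * ennreal (K r)"
        by (rule nn_integral_multc) measurable
      also have "\<dots> \<le> ennreal (u x) * ennreal (K r)"
        by (intro mult_right_mono sph elim) simp
      finally show ?case .
    qed
  qed
  also have "\<dots> = ennreal (u x) * (\<integral>\<^sup>+z. ennreal (k z) \<partial>lborel)"
    by (simp add: nn_integral_cmult nn_integral_distr kK[symmetric])
  finally show ?thesis .
qed

text \<open>
  What is compared with spheres is \<open>\<mu>\<close> smoothed by a Gaussian, which has a radial density; lower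
  semicontinuity of \<open>u\<close> recovers \<open>\<mu>\<close> itself as the variance tends to zero.
\<close>

lemma superharmonic_radial_law:
  fixes u :: "real ^ 'n \<Rightarrow> real" and \<mu> :: "(real ^ 'n) measure"
  assumes u: "superharmonic u" "\<And>x. u x \<ge> 0"
    and "prob_space \<mu>" and sets [measurable_cong]: "sets \<mu> = sets borel"
    and q: "\<And>\<xi>. (CLINT y|\<mu>. iexp (\<xi> \<bullet> y)) = q (norm \<xi>)"
  shows "(\<integral>\<^sup>+y. ennreal (u (x + y)) \<partial>\<mu>) \<le> ennreal (u x)"
proof -
  interpret \<mu>: prob_space \<mu> by fact
  interpret P: pair_sigma_finite \<mu> "lborel :: (real ^ 'n) measure" ..
  have lsc: "lower_semicontinuous u" using u by (simp add: superharmonic_def)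
  have um[measurable]: "u \<in> borel_measurable borel"
    by (rule lower_semicontinuous_measurable) fact
  define g :: "real ^ 'n \<Rightarrow> real" where "g w = exp (- (norm w)\<^sup>2 / 2)" for w
  have [measurable]: "g \<in> borel_measurable borel" unfolding g_def[abs_def] by measurable
  have g0: "g w > 0" for w by (simp add: g_def)
  define c where "c = (\<integral>\<^sup>+w. ennreal (g w) \<partial>lborel)"
  have c: "c \<noteq> 0" "c \<noteq> \<infinity>"
  proof -
    let ?k = "(1 / sqrt (2 * pi)) ^ DIM(real ^ 'n)"
    have "1 = (\<integral>\<^sup>+w. ennreal (gauss_density w) \<partial>(lborel :: (real^'n) measure))"
      using prob_space.emeasure_space_1[OF prob_space_gauss[where 'a = "real ^ 'n"]]
      by (simp add: emeasure_density)
    also have "\<dots> = ennreal ?k * c"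
      unfolding c_def by (subst nn_integral_cmult[symmetric]) (auto simp: gauss_density_eq g_def ennreal_mult)
    finally have *: "ennreal ?k * c = 1" by simp
    show "c \<noteq> 0" using * by auto
    show "c \<noteq> \<infinity>" using * by (auto simp: ennreal_mult_top)
  qed
  \<comment> \<open>The inequality for \<open>\<mu>\<close> smoothed at scale \<open>1/s\<close>, with the smoothing variable rescaled so that the
    Gaussian weight does not depend on \<open>s\<close>.\<close>
  have scale: "(\<integral>\<^sup>+y. (\<integral>\<^sup>+w. ennreal (u (x + y + w /\<^sub>R s)) * ennreal (g w) \<partial>lborel) \<partial>\<mu>) \<le> c * ennreal (u x)"
    if s: "s > 0" for s :: real
  proof -
    define h where "h z = (LINT y|\<mu>. g (s *\<^sub>R (z - y)))" for z
    have hr: "h z = h z'" if "norm z = norm z'" for z z'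
      unfolding h_def g_def by (rule gauss_smoothing_radial[OF assms(3) sets q that])
    have h0: "h z \<ge> 0" for z unfolding h_def using g0 by (auto intro: Bochner_Integration.integral_nonneg less_imp_le)
    have [measurable]: "h \<in> borel_measurable borel" unfolding h_def[abs_def] by measurable
    have hn: "ennreal (h z) = (\<integral>\<^sup>+y. ennreal (g (s *\<^sub>R (z - y))) \<partial>\<mu>)" for z
      unfolding h_def
    proof (rule nn_integral_eq_integral[symmetric])
      show "integrable \<mu> (\<lambda>y. g (s *\<^sub>R (z - y)))"
        by (rule \<mu>.integrable_const_bound[where B = 1]) (auto simp: g_def)
    qed (auto simp: g_def)
    define d where "d = ennreal (s ^ DIM(real ^ 'n))"
    have d: "d \<noteq> 0" "d \<noteq> \<infinity>" using s by (auto simp: d_def)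
    have sub: "(\<integral>\<^sup>+w. f w * ennreal (g w) \<partial>lborel) = d * (\<integral>\<^sup>+z. f (s *\<^sub>R (z - y)) * ennreal (g (s *\<^sub>R (z - y))) \<partial>lborel)"
      if [measurable]: "f \<in> borel_measurable borel" for f :: "real ^ 'n \<Rightarrow> ennreal" and y
    proof -
      have "(\<integral>\<^sup>+w. f w * ennreal (g w) \<partial>lborel) = (\<integral>\<^sup>+w. f w * ennreal (g w) \<partial>density (distr lborel borel (\<lambda>z. - (s *\<^sub>R y) + s *\<^sub>R z)) (\<lambda>_. ennreal (\<bar>s\<bar> ^ DIM(real^'n))))"
        using s by (subst lborel_affine[of s "- (s *\<^sub>R y)"]) auto
      also have "\<dots> = d * (\<integral>\<^sup>+z. f (- (s *\<^sub>R y) + s *\<^sub>R z) * ennreal (g (- (s *\<^sub>R y) + s *\<^sub>R z)) \<partial>lborel)"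
        using s by (simp add: d_def nn_integral_density nn_integral_distr nn_integral_cmult)
      finally show ?thesis by (simp add: algebra_simps)
    qed
    have "(\<integral>\<^sup>+y. (\<integral>\<^sup>+w. ennreal (u (x + y + w /\<^sub>R s)) * ennreal (g w) \<partial>lborel) \<partial>\<mu>)
       = (\<integral>\<^sup>+y. d * (\<integral>\<^sup>+z. ennreal (u (x + z)) * ennreal (g (s *\<^sub>R (z - y))) \<partial>lborel) \<partial>\<mu>)"
    proof (rule nn_integral_cong)
      fix y
      show "(\<integral>\<^sup>+w. ennreal (u (x + y + w /\<^sub>R s)) * ennreal (g w) \<partial>lborel) = 
        d * (\<integral>\<^sup>+z. ennreal (u (x + z)) * ennreal (g (s *\<^sub>R (z - y))) \<partial>lborel)"
        using s by (subst sub[of _ y]) (auto simp: algebra_simps)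
    qed
    also have "\<dots> = d * (\<integral>\<^sup>+y. (\<integral>\<^sup>+z. ennreal (u (x + z)) * ennreal (g (s *\<^sub>R (z - y))) \<partial>lborel) \<partial>\<mu>)"
      by (rule nn_integral_cmult) measurable
    also have "\<dots> = d * (\<integral>\<^sup>+z. (\<integral>\<^sup>+y. ennreal (u (x + z)) * ennreal (g (s *\<^sub>R (z - y))) \<partial>\<mu>) \<partial>lborel)"
      by (subst P.Fubini') auto
    also have "\<dots> = d * (\<integral>\<^sup>+z. ennreal (u (x + z)) * ennreal (h z) \<partial>lborel)"
      by (simp add: nn_integral_cmult hn)
    also have "\<dots> \<le> d * (ennreal (u x) * (\<integral>\<^sup>+z. ennreal (h z) \<partial>lborel))"
      by (intro mult_left_mono superharmonic_radial_weight u h0 hr) auto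
    also have "(\<integral>\<^sup>+z. ennreal (h z) \<partial>lborel) = (\<integral>\<^sup>+y. (\<integral>\<^sup>+z. ennreal (g (s *\<^sub>R (z - y))) \<partial>lborel) \<partial>\<mu>)"
      unfolding hn by (subst P.Fubini') auto
    also have "d * (ennreal (u x) * \<dots>) = ennreal (u x) * (\<integral>\<^sup>+y. d * (\<integral>\<^sup>+z. ennreal (g (s *\<^sub>R (z - y))) \<partial>lborel) \<partial>\<mu>)"
      by (subst nn_integral_cmult) (auto simp: ac_simps)
    also have "\<dots> = ennreal (u x) * (\<integral>\<^sup>+y. c \<partial>\<mu>)"
      unfolding c_def using sub[of "\<lambda>_. 1"] by simp
    also have "\<dots> = c * ennreal (u x)"
      by (simp add: \<mu>.emeasure_space_1 mult.commute)
    finally show ?thesis .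
  qed
  have "(\<integral>\<^sup>+y. ennreal (u (x + y)) \<partial>\<mu>) * c = (\<integral>\<^sup>+y. (\<integral>\<^sup>+w. ennreal (u (x + y)) * ennreal (g w) \<partial>lborel) \<partial>\<mu>)"
    by (simp add: nn_integral_cmult nn_integral_multc c_def)
  also have "\<dots> \<le> (\<integral>\<^sup>+y. (\<integral>\<^sup>+w. liminf (\<lambda>n. ennreal (u (x + y + w /\<^sub>R real (Suc n))) * ennreal (g w)) \<partial>lborel) \<partial>\<mu>)"
  proof (intro nn_integral_mono)
    fix y w
    have "(\<lambda>n. x + y + inverse (real (Suc n)) *\<^sub>R w) \<longlonglongrightarrow> x + y + 0 *\<^sub>R w"
      by (intro tendsto_intros LIMSEQ_inverse_real_of_nat)
    moreover have "lower_semicontinuous (\<lambda>z. u z * g w)"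
      using lsc g0[of w] by (simp add: lower_semicontinuous_def flip: pos_divide_less_eq)
    ultimately have "ennreal (u (x + y) * g w) \<le> liminf (\<lambda>n. ennreal (u (x + y + w /\<^sub>R real (Suc n)) * g w))"
      by (intro lower_semicontinuous_le_liminf) simp_all
    then show "ennreal (u (x + y)) * ennreal (g w) \<le> liminf (\<lambda>n. ennreal (u (x + y + w /\<^sub>R real (Suc n))) * ennreal (g w))"
      using u(2) g0[of w] by (simp add: ennreal_mult)
  qed
  also have "\<dots> \<le> (\<integral>\<^sup>+y. liminf (\<lambda>n. \<integral>\<^sup>+w. ennreal (u (x + y + w /\<^sub>R real (Suc n))) * ennreal (g w) \<partial>lborel) \<partial>\<mu>)"
    by (intro nn_integral_mono nn_integral_liminf) measurable
  also have "\<dots> \<le> liminf (\<lambda>n. \<integral>\<^sup>+y. (\<integral>\<^sup>+w. ennreal (u (x + y + w /\<^sub>R real (Suc n))) * ennreal (g w) \<partial>lborel) \<partial>\<mu>)"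
    by (intro nn_integral_liminf) measurable
  also have "\<dots> \<le> liminf (\<lambda>n::nat. c * ennreal (u x))"
    by (intro Liminf_mono always_eventually allI scale) simp
  also have "\<dots> = ennreal (u x) * c"
    by (simp add: Liminf_const mult.commute)
  finally have "(\<integral>\<^sup>+y. ennreal (u (x + y)) \<partial>\<mu>) * c \<le> ennreal (u x) * c" .
  then show ?thesis
    using c by (metis ennreal_mult_le_mult_iff infinity_ennreal_def mult.commute)
qed


section \<open>Cadlag paths and hitting times\<close>

lemma right_limit_sequentially:
  fixes p :: "real \<Rightarrow> 'a::metric_space"
  assumes p: "(p \<longlongrightarrow> p t) (at_right t)" and s: "s \<longlonglongrightarrow> t" "\<And>n. t \<le> s n"
  shows "(\<lambda>n. p (s n)) \<longlonglongrightarrow> p t"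
proof (rule tendstoI)
  fix e :: real assume "e > 0"
  then have "\<forall>\<^sub>F y in at_right t. dist (p y) (p t) < e"
    using p by (rule tendstoD[rotated])
  then obtain b where b: "b > t" "\<And>y. t < y \<Longrightarrow> y < b \<Longrightarrow> dist (p y) (p t) < e"
    by (auto simp: eventually_at_right_field)
  have "\<forall>\<^sub>F n in sequentially. s n < b"
    using s(1) b(1) by (rule order_tendstoD)
  then show "\<forall>\<^sub>F n in sequentially. dist (p (s n)) (p t) < e"
  proof eventually_elim
    case (elim n)
    then show ?case using b(2)[of "s n"] s(2)[of n] \<open>e > 0\<close> by (cases "s n = t") auto
  qed
qed

text \<open>
  Either the sequence reaches its limit, and is constant from then on, or it stays below and the
  left limit of the path applies.
\<close>

lemma cadlag_increasing_limit:
  fixes p :: "real \<Rightarrow> 'a::metric_space"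
  assumes p: "cadlag p" and s: "s \<longlonglongrightarrow> t" "incseq s" "\<And>n. 0 \<le> s n"
  obtains l where "(\<lambda>n. p (s n)) \<longlonglongrightarrow> l"
proof (cases "\<exists>n. s n = t")
  case True
  then obtain N where N: "s N = t" by auto
  have le: "s n \<le> t" for n using s by (intro incseq_le)
  have "s n = t" if "n \<ge> N" for n
    using incseqD[OF s(2) that] le[of n] N by simp
  then have "\<forall>\<^sub>F n in sequentially. p (s n) = p t"
    by (auto simp: eventually_sequentially)
  then show thesis by (intro that tendsto_eventually)
next
  case False
  have "s n \<le> t" for n using s by (intro incseq_le)
  with False have lt: "s n < t" for n by (simp add: less_le)
  then have "0 < t" using s(3)[of 0] by (meson le_less_trans)
  then obtain l where l: "(p \<longlongrightarrow> l) (at_left t)"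
    using p by (auto simp: cadlag_def)
  have "filterlim s (at_left t) sequentially"
    using s(1) lt by (auto simp: filterlim_at intro!: always_eventually)
  then show thesis by (rule that[OF filterlim_compose[OF l]])
qed

lemma dyadic_successor:
  fixes t :: real and n :: nat
  assumes "0 \<le> t"
  defines "k \<equiv> nat \<lfloor>t * 2 ^ n\<rfloor> + 1"
  shows "t < real k * (1 / 2 ^ n)" "real k * (1 / 2 ^ n) \<le> t + (1/2) ^ n"
proof -
  have "real k = of_int \<lfloor>t * 2 ^ n\<rfloor> + 1"
    using assms(1) by (simp add: k_def of_nat_nat)
  then have k: "t * 2 ^ n < real k" "real k \<le> t * 2 ^ n + 1"
    by linarith+
  show "t < real k * (1 / 2 ^ n)" using k(1) by (simp add: field_simps)
  have "real k * (1 / 2 ^ n) \<le> (t * 2 ^ n + 1) * (1 / 2 ^ n)"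
    using k(2) by (intro mult_right_mono) auto
  then show "real k * (1 / 2 ^ n) \<le> t + (1/2) ^ n"
    by (simp add: field_simps power_divide)
qed

definition grid_hit :: "'a set \<Rightarrow> real \<Rightarrow> nat \<Rightarrow> (real \<Rightarrow> 'a) \<Rightarrow> nat" where
  "grid_hit C d K p = (LEAST j. p (real j * d) \<in> C \<or> K \<le> j)"

lemma grid_hit_le: "grid_hit C d K p \<le> K"
  unfolding grid_hit_def by (rule Least_le) simp

lemma not_in_before_grid_hit: "i < grid_hit C d K p \<Longrightarrow> p (real i * d) \<notin> C"
  unfolding grid_hit_def by (drule not_less_Least) simp

text \<open>
  The event that the grid walk stops at \<open>j\<close> is a cylinder in the positions up to index \<open>j\<close>; this
  is what makes the index a stopping time.
\<close>

lemma grid_hit_eq_iff: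
  assumes "j \<le> K"
  shows "grid_hit C d K p = j \<longleftrightarrow>
    (\<forall>i\<le>j. p (real i * d) \<in> (if i < j then - C else if j < K then C else UNIV))"
proof
  assume j: "grid_hit C d K p = j"
  have "p (real j * d) \<in> C \<or> K \<le> j"
    unfolding j[symmetric] grid_hit_def by (rule LeastI[of _ K]) simp
  moreover have "p (real i * d) \<notin> C" if "i < j" for i
    using that j by (intro not_in_before_grid_hit[of i C d K]) simp
  ultimately show "\<forall>i\<le>j. p (real i * d) \<in> (if i < j then - C else if j < K then C else UNIV)"
    by (auto simp: not_less)
next
  assume *: "\<forall>i\<le>j. p (real i * d) \<in> (if i < j then - C else if j < K then C else UNIV)"
  show "grid_hit C d K p = j"
    unfolding grid_hit_def
  proof (rule Least_equality)
    show "p (real j * d) \<in> C \<or> K \<le> j" using *[rule_format, of j] assms by (auto split: if_splits)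
    fix i assume i: "p (real i * d) \<in> C \<or> K \<le> i"
    show "j \<le> i"
    proof (rule ccontr)
      assume "\<not> j \<le> i"
      then show False using *[rule_format, of i] i assms by auto
    qed
  qed
qed

text \<open>
  The cap \<open>c\<close> keeps the set nonempty when the path avoids \<open>G\<close>, and the times bounded.
\<close>

definition hit :: "'a set \<Rightarrow> real \<Rightarrow> (real \<Rightarrow> 'a) \<Rightarrow> real" where
  "hit G c p = Inf (insert c {t. 0 \<le> t \<and> p t \<in> G})"

lemma hit_bdd: "bdd_below (insert c {t. 0 \<le> t \<and> p t \<in> G})" for c :: real
  by (rule bdd_belowI[of _ "min c 0"]) auto

lemma hit_le: "hit G c p \<le> c"
  unfolding hit_def by (rule cInf_lower) (auto intro: hit_bdd)

lemma hit_le_time: "0 \<le> t \<Longrightarrow> p t \<in> G \<Longrightarrow> hit G c p \<le> t"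
  unfolding hit_def by (rule cInf_lower) (auto intro: hit_bdd)

lemma hit_nonneg: "0 \<le> c \<Longrightarrow> 0 \<le> hit G c p"
  unfolding hit_def by (rule cInf_greatest) auto

lemma hit_antimono: "G \<subseteq> G' \<Longrightarrow> hit G' c p \<le> hit G c p"
  unfolding hit_def by (rule cInf_superset_mono) (auto intro: hit_bdd)

lemma hit_less:
  assumes "hit G c p < r"
  obtains "c < r" | t where "0 \<le> t" "p t \<in> G" "t < r"
  using assms unfolding hit_def by (subst (asm) cInf_less_iff) (auto intro: hit_bdd)

text \<open>
  If the path were outside the closure at this time, right-continuity would keep it outside for
  a while longer.
\<close>

lemma hit_in_closure:
  fixes p :: "real \<Rightarrow> 'a::metric_space"
  assumes p: "cadlag p" and c: "0 \<le> c" "hit G c p < c"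
  shows "p (hit G c p) \<in> closure G"
proof (rule ccontr)
  let ?h = "hit G c p"
  assume n: "p ?h \<notin> closure G"
  have "0 \<le> ?h" using c by (simp add: hit_nonneg)
  then have "(p \<longlongrightarrow> p ?h) (at_right ?h)" using p by (auto simp: cadlag_def)
  then have "\<forall>\<^sub>F y in at_right ?h. p y \<in> - closure G"
    using n by (intro topological_tendstoD) auto
  then obtain b where b: "b > ?h" "\<And>y. ?h < y \<Longrightarrow> y < b \<Longrightarrow> p y \<notin> closure G"
    by (auto simp: eventually_at_right_field)
  from b c have "?h < min b c" by simp
  then show False
  proof (cases rule: hit_less)
    case (2 t)
    then have "?h \<le> t" by (intro hit_le_time)
    moreover have "p t \<in> closure G" using 2 closure_subset by auto
    ultimately show False using 2 b(2)[of t] n by (cases "?h = t") auto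
  qed simp
qed

text \<open>
  A path that is in the open set \<open>G\<close> at time \<open>t\<close> stays there for a while after \<open>t\<close>, and the next
  point of a fine enough dyadic grid falls into that period.
\<close>

lemma grid_hit_tendsto_hit:
  fixes p :: "real \<Rightarrow> 'a::metric_space" and c :: nat
  assumes p: "cadlag p" and G: "open G"
  shows "hit G (real c) p \<le> real (grid_hit G (1 / 2 ^ m) (c * 2 ^ m) p) * (1 / 2 ^ m)" (is "_ \<le> ?S m")
    and "(\<lambda>m. real (grid_hit G (1 / 2 ^ m) (c * 2 ^ m) p) * (1 / 2 ^ m)) \<longlonglongrightarrow> hit G (real c) p"
proof -
  let ?h = "hit G (real c) p"
  let ?J = "\<lambda>m. grid_hit G (1 / 2 ^ m) (c * 2 ^ m) p"
  let ?S = "\<lambda>m. real (?J m) * (1 / 2 ^ m)"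
  have lower: "?h \<le> ?S m" for m
  proof -
    have "p (?S m) \<in> G \<or> c * 2 ^ m \<le> ?J m"
      unfolding grid_hit_def by (rule LeastI[of _ "c * 2 ^ m"]) simp
    then show ?thesis
    proof
      assume "p (?S m) \<in> G" then show ?thesis by (intro hit_le_time) auto
    next
      assume "c * 2 ^ m \<le> ?J m"
      then have "real (c * 2 ^ m) \<le> real (?J m)" by (simp only: of_nat_le_iff)
      then have "real c \<le> ?S m" by (simp add: field_simps)
      then show ?thesis using hit_le[of G "real c" p] by simp
    qed
  qed
  then show "?h \<le> ?S m" .
  have upper: "?S m \<le> real c" for m
  proof -
    have "real (?J m) \<le> real (c * 2 ^ m)" by (simp only: of_nat_le_iff grid_hit_le)
    then show ?thesis by (simp add: field_simps)
  qed
  show "?S \<longlonglongrightarrow> ?h"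
  proof (rule order_tendstoI)
    fix a assume "a < ?h" then show "\<forall>\<^sub>F m in sequentially. a < ?S m"
      using lower by (intro always_eventually allI) (meson less_le_trans)
  next
    fix a assume a: "?h < a"
    show "\<forall>\<^sub>F m in sequentially. ?S m < a"
    proof (cases "real c < a")
      case True
      then show ?thesis using upper by (intro always_eventually allI) (meson le_less_trans)
    next
      case False
      from a obtain t where t: "0 \<le> t" "p t \<in> G" "t < a"
        by (rule hit_less) (use False in auto)
      have "(p \<longlongrightarrow> p t) (at_right t)" using p t by (auto simp: cadlag_def)
      then have "\<forall>\<^sub>F y in at_right t. p y \<in> G"
        using t G by (intro topological_tendstoD) auto
      then obtain b where b: "b > t" "\<And>y. t < y \<Longrightarrow> y < b \<Longrightarrow> p y \<in> G"
        by (auto simp: eventually_at_right_field)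
      let ?b = "min a b"
      have "(\<lambda>m. (1/2) ^ m :: real) \<longlonglongrightarrow> 0" by (intro LIMSEQ_power_zero) simp
      then have "\<forall>\<^sub>F m in sequentially. (1/2) ^ m < ?b - t"
        using t b by (intro order_tendstoD) auto
      then show ?thesis
      proof eventually_elim
        case (elim m)
        let ?k = "nat \<lfloor>t * 2 ^ m\<rfloor> + 1"
        have k1: "t < real ?k * (1 / 2 ^ m)" using dyadic_successor(1)[OF t(1)] .
        have "real ?k * (1 / 2 ^ m) \<le> t + (1/2) ^ m" using dyadic_successor(2)[OF t(1)] .
        also have "\<dots> < ?b" using elim by linarith
        finally have k2: "real ?k * (1 / 2 ^ m) < ?b" .
        have "p (real ?k * (1 / 2 ^ m)) \<in> G" using k1 k2 by (intro b(2)) auto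
        then have "?J m \<le> ?k" unfolding grid_hit_def by (intro Least_le) simp
        then have "?S m \<le> real ?k * (1 / 2 ^ m)" by (intro mult_right_mono) auto
        then show ?case using k2 by simp
      qed
    qed
  qed
qed

section \<open>Sampling the process at grid times\<close>

text \<open>
  A process with cadlag paths for every outcome, starting exactly at the origin.  Of
  the stationary and independent increments only the simple Markov property on uniform grids is kept:
  given any cylinder event up to time \<open>jd\<close>, the next increment of length \<open>e\<close> is distributed
  as \<open>X\<^sub>e\<close> and independent of the position at time \<open>jd\<close>.
\<close>

locale regular_levy = prob_space M for M :: "'w measure" +
  fixes X :: "real \<Rightarrow> 'w \<Rightarrow> 'a::euclidean_space"
  assumes X_measurable: "0 \<le> t \<Longrightarrow> X t \<in> borel_measurable M"
    and X_0: "X 0 \<omega> = 0"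
    and X_cadlag: "cadlag (\<lambda>t. X t \<omega>)"
    and markov: "\<lbrakk>0 \<le> d; 0 \<le> e; \<And>i. C i \<in> sets borel;
        case_prod f \<in> borel_measurable (borel \<Otimes>\<^sub>M borel)\<rbrakk> \<Longrightarrow>
      (\<integral>\<^sup>+\<omega>. indicator {\<omega>. \<forall>i\<le>j. X (real i * d) \<omega> \<in> C i} \<omega>
           * f (X (real j * d) \<omega>) (X (real j * d + e) \<omega> - X (real j * d) \<omega>) \<partial>M)
      = (\<integral>\<^sup>+\<omega>. indicator {\<omega>. \<forall>i\<le>j. X (real i * d) \<omega> \<in> C i} \<omega>
           * (\<integral>\<^sup>+y. f (X (real j * d) \<omega>) y \<partial>distr M borel (X e)) \<partial>M)"
begin

lemma X_right: "0 \<le> t \<Longrightarrow> ((\<lambda>t. X t \<omega>) \<longlongrightarrow> X t \<omega>) (at_right t)"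
  using X_cadlag[of \<omega>] by (simp add: cadlag_def)

text \<open>
  Round the random time up to the next point of a dyadic grid and use right-continuity.
\<close>

lemma measurable_random_time:
  assumes S[measurable]: "S \<in> borel_measurable M" and S0: "\<And>\<omega>. 0 \<le> S \<omega>"
  shows "(\<lambda>\<omega>. X (S \<omega>) \<omega>) \<in> borel_measurable M"
proof (rule borel_measurable_LIMSEQ_metric)
  define k where "k n \<omega> = nat \<lfloor>S \<omega> * 2 ^ n\<rfloor> + 1" for n \<omega>
  have [measurable]: "k n \<in> measurable M (count_space UNIV)" for n
    unfolding k_def by measurable
  show "(\<lambda>\<omega>. X (real (k n \<omega>) * (1 / 2 ^ n)) \<omega>) \<in> borel_measurable M" for n
    by (rule measurable_compose_countable[where f = "\<lambda>k. X (real k * (1 / 2 ^ n))", OF X_measurable]) auto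
  fix \<omega>
  have b: "S \<omega> \<le> real (k n \<omega>) * (1 / 2 ^ n)" "real (k n \<omega>) * (1 / 2 ^ n) \<le> S \<omega> + (1/2) ^ n" for n
    using dyadic_successor[OF S0[of \<omega>], of n] unfolding k_def by auto
  have "(\<lambda>n. S \<omega> + (1/2) ^ n) \<longlonglongrightarrow> S \<omega> + 0"
    by (intro tendsto_intros LIMSEQ_power_zero) simp
  then have "(\<lambda>n. S \<omega> + (1/2) ^ n) \<longlonglongrightarrow> S \<omega>" by simp
  then have "(\<lambda>n. real (k n \<omega>) * (1 / 2 ^ n)) \<longlonglongrightarrow> S \<omega>"
    by (rule tendsto_sandwich[OF always_eventually always_eventually tendsto_const, rotated 2]) (use b in blast)+
  then show "(\<lambda>n. X (real (k n \<omega>) * (1 / 2 ^ n)) \<omega>) \<longlonglongrightarrow> X (S \<omega>) \<omega>"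
    using b(1) by (intro right_limit_sequentially[where p = "\<lambda>t. X t \<omega>"] X_right S0)
qed

lemma measurable_grid_hit:
  assumes "0 \<le> d" and [measurable]: "C \<in> sets borel"
  shows "(\<lambda>\<omega>. grid_hit C d K (\<lambda>t. X t \<omega>)) \<in> measurable M (count_space UNIV)"
proof -
  have [measurable]: "X (real i * d) \<in> borel_measurable M" for i
    using assms by (intro X_measurable) simp
  show ?thesis unfolding grid_hit_def by measurable
qed

text \<open>
  The strong Markov property at a grid hitting time: decompose according to the value of the
  index.
\<close>

lemma grid_increment:
  fixes f :: "'a \<Rightarrow> ennreal"
  assumes d: "0 \<le> d" and e: "0 \<le> e" and C[measurable]: "C \<in> sets borel"
    and f[measurable]: "f \<in> borel_measurable borel"
  shows "(\<integral>\<^sup>+\<omega>. f (X (real (grid_hit C d K (\<lambda>t. X t \<omega>)) * d + e) \<omega> - X (real (grid_hit C d K (\<lambda>t. X t \<omega>)) * d) \<omega>) \<partial>M)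
       = (\<integral>\<^sup>+\<omega>. f (X e \<omega>) \<partial>M)"
proof -
  let ?J = "\<lambda>\<omega>. grid_hit C d K (\<lambda>t. X t \<omega>)"
  note [measurable] = measurable_grid_hit[OF d C]
  have [measurable]: "X (real i * d) \<in> borel_measurable M" "X (real i * d + e) \<in> borel_measurable M"
     "X e \<in> borel_measurable M" for i
    using d e by (auto intro!: X_measurable)
  \<comment> \<open>The cylinder on which the walk stops at \<open>j\<close>.\<close>
  define Cj where "Cj j i = (if i < j then - C else if j < K then C else UNIV)" for i j :: nat
  have Cj: "Cj j i \<in> sets borel" for i j by (simp add: Cj_def)
  have ev: "?J \<omega> = j \<longleftrightarrow> \<omega> \<in> {\<omega>. \<forall>i\<le>j. X (real i * d) \<omega> \<in> Cj j i}" if "j \<le> K" for \<omega> j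
    using grid_hit_eq_iff[OF that, of C d "\<lambda>t. X t \<omega>"] by (simp add: Cj_def)
  have dec: "F (?J \<omega>) = (\<Sum>j\<le>K. indicator {\<omega>. ?J \<omega> = j} \<omega> * F j)" for F :: "nat \<Rightarrow> ennreal" and \<omega>
  proof -
    have "(\<Sum>j\<le>K. indicator {\<omega>. ?J \<omega> = j} \<omega> * F j) = (\<Sum>j\<in>{?J \<omega>}. indicator {\<omega>. ?J \<omega> = j} \<omega> * F j)"
      by (rule sum.mono_neutral_right) (auto simp: grid_hit_le)
    then show ?thesis by simp
  qed
  let ?c = "\<integral>\<^sup>+\<omega>. f (X e \<omega>) \<partial>M"
  have "(\<integral>\<^sup>+\<omega>. f (X (real (?J \<omega>) * d + e) \<omega> - X (real (?J \<omega>) * d) \<omega>) \<partial>M)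
     = (\<integral>\<^sup>+\<omega>. (\<Sum>j\<le>K. indicator {\<omega>. ?J \<omega> = j} \<omega> * f (X (real j * d + e) \<omega> - X (real j * d) \<omega>)) \<partial>M)"
    by (intro nn_integral_cong) (rule dec[of "\<lambda>j. f (X (real j * d + e) _ - X (real j * d) _)"])
  also have "\<dots> = (\<Sum>j\<le>K. \<integral>\<^sup>+\<omega>. indicator {\<omega>. ?J \<omega> = j} \<omega> * f (X (real j * d + e) \<omega> - X (real j * d) \<omega>) \<partial>M)"
    by (rule nn_integral_sum) measurable
  also have "\<dots> = (\<Sum>j\<le>K. \<integral>\<^sup>+\<omega>. indicator {\<omega>. ?J \<omega> = j} \<omega> * ?c \<partial>M)"
  proof (rule sum.cong[OF refl])
    fix j assume "j \<in> {..K}"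
    then have "{\<omega>. ?J \<omega> = j} = {\<omega>. \<forall>i\<le>j. X (real i * d) \<omega> \<in> Cj j i}" using ev by auto
    moreover have "(\<integral>\<^sup>+y. f y \<partial>distr M borel (X e)) = ?c" by (simp add: nn_integral_distr)
    ultimately show "(\<integral>\<^sup>+\<omega>. indicator {\<omega>. ?J \<omega> = j} \<omega> * f (X (real j * d + e) \<omega> - X (real j * d) \<omega>) \<partial>M)
      = (\<integral>\<^sup>+\<omega>. indicator {\<omega>. ?J \<omega> = j} \<omega> * ?c \<partial>M)"
      using markov[where f = "\<lambda>_. f", OF d e Cj] by simp
  qed
  also have "\<dots> = (\<integral>\<^sup>+\<omega>. (\<Sum>j\<le>K. indicator {\<omega>. ?J \<omega> = j} \<omega> * ?c) \<partial>M)"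
    by (rule nn_integral_sum[symmetric]) measurable
  also have "\<dots> = (\<integral>\<^sup>+\<omega>. ?c \<partial>M)"
    by (intro nn_integral_cong) (rule dec[of "\<lambda>_. ?c", symmetric])
  finally show ?thesis by (simp add: emeasure_space_1)
qed

text \<open>
  Optional stopping, by induction on the cap: raising it from \<open>K\<close> to \<open>K + 1\<close> changes the
  outcome only on the event that no hit has occurred up to \<open>K\<close>, and there the mean value inequality
  shows that one more step does not increase the expectation.
\<close>

lemma grid_supermartingale:
  fixes v :: "'a \<Rightarrow> ennreal"
  assumes d: "0 \<le> d" and C[measurable]: "C \<in> sets borel"
    and v[measurable]: "v \<in> borel_measurable borel"
    and mean: "\<And>z. (\<integral>\<^sup>+y. v (z + y) \<partial>distr M borel (X d)) \<le> v z"
  shows "(\<integral>\<^sup>+\<omega>. v (X (real (grid_hit C d K (\<lambda>t. X t \<omega>)) * d) \<omega>) \<partial>M) \<le> v 0"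
proof (induction K)
  case 0
  have "grid_hit C d 0 p = 0" for p using grid_hit_le[of C d 0 p] by simp
  then show ?case by (simp add: X_0 emeasure_space_1)
next
  case (Suc K)
  let ?J = "\<lambda>K \<omega>. grid_hit C d K (\<lambda>t. X t \<omega>)"
  let ?Y = "\<lambda>K \<omega>. X (real (?J K \<omega>) * d) \<omega>"
  define A where "A = {\<omega>. \<forall>i\<le>K. X (real i * d) \<omega> \<in> - C}"
  have Xm[measurable]: "X (real i * d) \<in> borel_measurable M" for i
    using d by (intro X_measurable) simp
  note [measurable] = measurable_grid_hit[OF d C]
  have [measurable]: "?Y K \<in> borel_measurable M" for K
    by (rule measurable_compose_countable[of "\<lambda>j. X (real j * d)"]) measurable
  have [measurable]: "Measurable.pred M (\<lambda>\<omega>. \<omega> \<in> A)" unfolding A_def by measurable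
  have inA: "?J (Suc K) \<omega> = Suc K" "?J K \<omega> = K" if "\<omega> \<in> A" for \<omega>
    using that by (subst grid_hit_eq_iff; auto simp: A_def)+
  have notA: "?J (Suc K) \<omega> = ?J K \<omega>" if notin: "\<omega> \<notin> A" for \<omega>
  proof -
    have J: "?J K \<omega> \<le> K" by (rule grid_hit_le)
    obtain i where i: "i \<le> K" "X (real i * d) \<omega> \<in> C" using notin by (auto simp: A_def)
    have inC: "X (real (?J K \<omega>) * d) \<omega> \<in> C"
    proof (cases "?J K \<omega> = K")
      case True
      then have "X (real k * d) \<omega> \<notin> C" if "k < K" for k
        using not_in_before_grid_hit[of k C d K "\<lambda>t. X t \<omega>"] that by simp
      then show ?thesis using i True by (cases "i = K") auto
    next
      case False
      then have "?J K \<omega> < K" using J by simp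
      then show ?thesis
        using grid_hit_eq_iff[OF J, of C d "\<lambda>t. X t \<omega>"] by auto
    qed
    then show ?thesis
      using J not_in_before_grid_hit[of _ C d K "\<lambda>t. X t \<omega>"]
      by (subst grid_hit_eq_iff) auto
  qed
  have C': "- C \<in> sets borel" by simp
  have step: "(\<integral>\<^sup>+\<omega>. indicator A \<omega> * v (X (real (Suc K) * d) \<omega>) \<partial>M) \<le> (\<integral>\<^sup>+\<omega>. indicator A \<omega> * v (X (real K * d) \<omega>) \<partial>M)"
  proof -
    have "(\<integral>\<^sup>+\<omega>. indicator A \<omega> * v (X (real (Suc K) * d) \<omega>) \<partial>M) = 
      (\<integral>\<^sup>+\<omega>. indicator A \<omega> * v (X (real K * d) \<omega> + (X (real K * d + d) \<omega> - X (real K * d) \<omega>)) \<partial>M)"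
      by (simp add: algebra_simps)
    also have "\<dots> = (\<integral>\<^sup>+\<omega>. indicator A \<omega> * (\<integral>\<^sup>+y. v (X (real K * d) \<omega> + y) \<partial>distr M borel (X d)) \<partial>M)"
      unfolding A_def by (rule markov[where f = "\<lambda>z y. v (z + y)" and C = "\<lambda>_. - C", OF d d C']) measurable
    also have "\<dots> \<le> (\<integral>\<^sup>+\<omega>. indicator A \<omega> * v (X (real K * d) \<omega>) \<partial>M)"
      by (intro nn_integral_mono mult_left_mono mean) auto
    finally show ?thesis .
  qed
  have "(\<integral>\<^sup>+\<omega>. v (?Y (Suc K) \<omega>) \<partial>M) = (\<integral>\<^sup>+\<omega>. indicator A \<omega> * v (X (real (Suc K) * d) \<omega>) + indicator (- A) \<omega> * v (?Y K \<omega>) \<partial>M)"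
    by (intro nn_integral_cong) (auto simp: indicator_def inA notA simp del: of_nat_Suc)
  also have "\<dots> = (\<integral>\<^sup>+\<omega>. indicator A \<omega> * v (X (real (Suc K) * d) \<omega>) \<partial>M) + (\<integral>\<^sup>+\<omega>. indicator (- A) \<omega> * v (?Y K \<omega>) \<partial>M)"
    by (rule nn_integral_add) measurable
  also have "\<dots> \<le> (\<integral>\<^sup>+\<omega>. indicator A \<omega> * v (X (real K * d) \<omega>) \<partial>M) + (\<integral>\<^sup>+\<omega>. indicator (- A) \<omega> * v (?Y K \<omega>) \<partial>M)"
    by (intro add_right_mono step)
  also have "\<dots> = (\<integral>\<^sup>+\<omega>. indicator A \<omega> * v (X (real K * d) \<omega>) + indicator (- A) \<omega> * v (?Y K \<omega>) \<partial>M)"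
    by (rule nn_integral_add[symmetric]) measurable
  also have "\<dots> = (\<integral>\<^sup>+\<omega>. v (?Y K \<omega>) \<partial>M)"
    by (intro nn_integral_cong) (auto simp: indicator_def inA)
  also have "\<dots> \<le> v 0" by (rule Suc.IH)
  finally show ?case .
qed

end


section \<open>Hitting times of open sets and quasi-left-continuity\<close>

context regular_levy
begin

lemma measurable_hit:
  fixes c :: nat
  assumes "open G"
  shows "(\<lambda>\<omega>. hit G (real c) (\<lambda>t. X t \<omega>)) \<in> borel_measurable M"
proof (rule borel_measurable_LIMSEQ_real)
  show "(\<lambda>m. real (grid_hit G (1 / 2 ^ m) (c * 2 ^ m) (\<lambda>t. X t \<omega>)) * (1 / 2 ^ m)) \<longlonglongrightarrow> hit G (real c) (\<lambda>t. X t \<omega>)" for \<omega>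
    using assms by (intro grid_hit_tendsto_hit X_cadlag)
  show "(\<lambda>\<omega>. real (grid_hit G (1 / 2 ^ m) (c * 2 ^ m) (\<lambda>t. X t \<omega>)) * (1 / 2 ^ m)) \<in> borel_measurable M" for m
  proof -
    have [measurable]: "(\<lambda>\<omega>. grid_hit G (1 / 2 ^ m) (c * 2 ^ m) (\<lambda>t. X t \<omega>)) \<in> measurable M (count_space UNIV)"
      using assms by (intro measurable_grid_hit) auto
    show ?thesis by measurable
  qed
qed

lemma X_at_grid_hit_tendsto:
  fixes c :: nat
  assumes "open G" "0 \<le> e"
  shows "(\<lambda>m. X (real (grid_hit G (1 / 2 ^ m) (c * 2 ^ m) (\<lambda>t. X t \<omega>)) * (1 / 2 ^ m) + e) \<omega>)
    \<longlonglongrightarrow> X (hit G (real c) (\<lambda>t. X t \<omega>) + e) \<omega>"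
  using assms grid_hit_tendsto_hit[OF X_cadlag assms(1), of c \<omega>] hit_nonneg[of "real c" G "\<lambda>t. X t \<omega>"]
  by (intro right_limit_sequentially[where p = "\<lambda>t. X t \<omega>"] X_right tendsto_add tendsto_const add_right_mono add_nonneg_nonneg) auto

lemma measurable_X_at_grid_hit:
  assumes "open G" "0 \<le> e" "0 \<le> d"
  shows "(\<lambda>\<omega>. X (real (grid_hit G d K (\<lambda>t. X t \<omega>)) * d + e) \<omega>) \<in> borel_measurable M"
  using assms measurable_grid_hit[of d G K]
  by (intro measurable_compose_countable[where f = "\<lambda>j. X (real j * d + e)", OF X_measurable]) auto

text \<open>
  Fatou's lemma turns the equality at grid times into an inequality.  This is enough for
  quasi-left-continuity, where the right-hand side tends to zero with \<open>e\<close>.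
\<close>

lemma hit_increment:
  fixes c :: nat and f :: "'a \<Rightarrow> real"
  assumes G: "open G" and e: "0 \<le> e" and f: "continuous_on UNIV f"
  shows "(\<integral>\<^sup>+\<omega>. ennreal (f (X (hit G (real c) (\<lambda>t. X t \<omega>) + e) \<omega> - X (hit G (real c) (\<lambda>t. X t \<omega>)) \<omega>)) \<partial>M)
    \<le> (\<integral>\<^sup>+\<omega>. ennreal (f (X e \<omega>)) \<partial>M)"
proof -
  let ?S = "\<lambda>m \<omega>. real (grid_hit G (1 / 2 ^ m) (c * 2 ^ m) (\<lambda>t. X t \<omega>)) * (1 / 2 ^ m)"
  let ?h = "\<lambda>\<omega>. hit G (real c) (\<lambda>t. X t \<omega>)"
  have lsc: "lower_semicontinuous f"
    using open_Collect_less[OF continuous_on_const f] by (simp add: lower_semicontinuous_def)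
  have [measurable]: "f \<in> borel_measurable borel" using f by (rule borel_measurable_continuous_onI)
  have [measurable]: "(\<lambda>\<omega>. X (?S m \<omega>) \<omega>) \<in> borel_measurable M" "(\<lambda>\<omega>. X (?S m \<omega> + e) \<omega>) \<in> borel_measurable M" for m
    using measurable_X_at_grid_hit[OF G, of 0 "1 / 2 ^ m" "c * 2 ^ m"] measurable_X_at_grid_hit[OF G e, of "1 / 2 ^ m" "c * 2 ^ m"] by auto
  have "(\<integral>\<^sup>+\<omega>. ennreal (f (X (?h \<omega> + e) \<omega> - X (?h \<omega>) \<omega>)) \<partial>M)
    \<le> (\<integral>\<^sup>+\<omega>. liminf (\<lambda>m. ennreal (f (X (?S m \<omega> + e) \<omega> - X (?S m \<omega>) \<omega>))) \<partial>M)"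
  proof (intro nn_integral_mono lower_semicontinuous_le_liminf[OF lsc] tendsto_diff)
    fix \<omega>
    show "(\<lambda>m. X (?S m \<omega> + e) \<omega>) \<longlonglongrightarrow> X (?h \<omega> + e) \<omega>" "(\<lambda>m. X (?S m \<omega>) \<omega>) \<longlonglongrightarrow> X (?h \<omega>) \<omega>"
      using X_at_grid_hit_tendsto[OF G e, of c \<omega>] X_at_grid_hit_tendsto[OF G order_refl, of c \<omega>] by simp_all
  qed
  also have "\<dots> \<le> liminf (\<lambda>m. \<integral>\<^sup>+\<omega>. ennreal (f (X (?S m \<omega> + e) \<omega> - X (?S m \<omega>) \<omega>)) \<partial>M)"
    by (rule nn_integral_liminf) measurable
  also have "\<dots> = liminf (\<lambda>m::nat. \<integral>\<^sup>+\<omega>. ennreal (f (X e \<omega>)) \<partial>M)"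
    using G by (subst grid_increment[where f = "\<lambda>z. ennreal (f z)", OF _ e]) auto
  finally show ?thesis by (simp add: Liminf_const)
qed

lemma hit_supermartingale:
  fixes c :: nat and u :: "'a \<Rightarrow> real"
  assumes G: "open G" and lsc: "lower_semicontinuous u"
    and mean: "\<And>z t. 0 \<le> t \<Longrightarrow> (\<integral>\<^sup>+y. ennreal (u (z + y)) \<partial>distr M borel (X t)) \<le> ennreal (u z)"
  shows "(\<integral>\<^sup>+\<omega>. ennreal (u (x + X (hit G (real c) (\<lambda>t. X t \<omega>)) \<omega>)) \<partial>M) \<le> ennreal (u x)"
proof -
  let ?S = "\<lambda>m \<omega>. real (grid_hit G (1 / 2 ^ m) (c * 2 ^ m) (\<lambda>t. X t \<omega>)) * (1 / 2 ^ m)"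
  let ?h = "\<lambda>\<omega>. hit G (real c) (\<lambda>t. X t \<omega>)"
  have [measurable]: "u \<in> borel_measurable borel" using lsc by (rule lower_semicontinuous_measurable)
  have [measurable]: "(\<lambda>\<omega>. X (?S m \<omega>) \<omega>) \<in> borel_measurable M" for m
    using measurable_X_at_grid_hit[OF G, of 0 "1 / 2 ^ m" "c * 2 ^ m"] by auto
  have "(\<integral>\<^sup>+\<omega>. ennreal (u (x + X (?h \<omega>) \<omega>)) \<partial>M) \<le> (\<integral>\<^sup>+\<omega>. liminf (\<lambda>m. ennreal (u (x + X (?S m \<omega>) \<omega>))) \<partial>M)"
  proof (intro nn_integral_mono lower_semicontinuous_le_liminf[OF lsc] tendsto_add tendsto_const)
    fix \<omega>
    show "(\<lambda>m. X (?S m \<omega>) \<omega>) \<longlonglongrightarrow> X (?h \<omega>) \<omega>"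
      using X_at_grid_hit_tendsto[OF G order_refl, of c \<omega>] by simp
  qed
  also have "\<dots> \<le> liminf (\<lambda>m. \<integral>\<^sup>+\<omega>. ennreal (u (x + X (?S m \<omega>) \<omega>)) \<partial>M)"
    by (rule nn_integral_liminf) measurable
  also have "\<dots> \<le> liminf (\<lambda>m::nat. ennreal (u x))"
  proof (intro Liminf_mono always_eventually allI)
    fix m
    show "(\<integral>\<^sup>+\<omega>. ennreal (u (x + X (?S m \<omega>) \<omega>)) \<partial>M) \<le> ennreal (u x)"
    proof -
      have "(\<integral>\<^sup>+y. ennreal (u (x + (z + y))) \<partial>distr M borel (X (1 / 2 ^ m))) \<le> ennreal (u (x + z))" for z
        using mean[of "1 / 2 ^ m" "x + z"] by (simp add: add.assoc)
      from grid_supermartingale[where v = "\<lambda>z. ennreal (u (x + z))", OF _ _ _ this, of G "c * 2 ^ m"]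
      show ?thesis using G by simp
    qed
  qed
  finally show ?thesis by (simp add: Liminf_const)
qed

text \<open>
  Right-continuity of the paths at time \<open>0\<close>.
\<close>

lemma increment_tendsto_0:
  "(\<lambda>k. \<integral>\<^sup>+\<omega>. ennreal (min 1 (norm (X (1 / real (Suc k)) \<omega>))) \<partial>M) \<longlonglongrightarrow> 0"
proof -
  have [measurable]: "X (1 / real (Suc k)) \<in> borel_measurable M" for k by (intro X_measurable) simp
  have "(\<lambda>k. \<integral>\<^sup>+\<omega>. ennreal (min 1 (norm (X (1 / real (Suc k)) \<omega>))) \<partial>M) \<longlonglongrightarrow> (\<integral>\<^sup>+\<omega>. 0 \<partial>M)"
  proof (rule nn_integral_dominated_convergence[where w = "\<lambda>_. 1"])
    show "AE \<omega> in M. (\<lambda>k. ennreal (min 1 (norm (X (1 / real (Suc k)) \<omega>)))) \<longlonglongrightarrow> 0"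
    proof (rule AE_I2)
      fix \<omega>
      have "(\<lambda>k. X (1 / real (Suc k)) \<omega>) \<longlonglongrightarrow> X 0 \<omega>"
        using LIMSEQ_inverse_real_of_nat
        by (intro right_limit_sequentially[where p = "\<lambda>t. X t \<omega>"] X_right) (auto simp: inverse_eq_divide)
      then have "(\<lambda>k. ennreal (min 1 (norm (X (1 / real (Suc k)) \<omega>)))) \<longlonglongrightarrow> ennreal (min 1 (norm (0 :: 'a)))"
        unfolding X_0 by (intro tendsto_ennrealI tendsto_intros)
      then show "(\<lambda>k. ennreal (min 1 (norm (X (1 / real (Suc k)) \<omega>)))) \<longlonglongrightarrow> 0" by simp
    qed
  qed (simp_all add: emeasure_space_1 del: of_nat_Suc)
  then show ?thesis by simp
qed

text \<open>
  Let \<open>S\<^sub>n\<close> increase to \<open>T\<close> and let \<open>Y\<close> be the limit of the positions at the times \<open>S\<^sub>n\<close>.  As \<open>n \<rightarrow> \<infinity>\<close>,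
  the increment from \<open>S\<^sub>n\<close> to \<open>S\<^sub>n + e\<close> tends to \<open>Z\<^sub>e - Y\<close> for a limit \<open>Z\<^sub>e\<close> of values of the path near
  \<open>T + e\<close>, and \<open>Z\<^sub>e\<close> tends to \<open>X\<^sub>T\<close> as \<open>e \<rightarrow> 0\<close>.  The truncated size of the increment has an expectation
  that is bounded independently of \<open>n\<close> and tends to zero with \<open>e\<close>, so \<open>X\<^sub>T = Y\<close> almost surely.
\<close>

lemma quasi_left_continuous:
  fixes S :: "nat \<Rightarrow> 'w \<Rightarrow> real"
  assumes Sm[measurable]: "\<And>n. S n \<in> borel_measurable M"
    and S0: "\<And>n \<omega>. 0 \<le> S n \<omega>" and inc: "\<And>\<omega>. incseq (\<lambda>n. S n \<omega>)"
    and lim: "\<And>\<omega>. (\<lambda>n. S n \<omega>) \<longlonglongrightarrow> T \<omega>"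
    and incr: "\<And>n e. 0 \<le> e \<Longrightarrow>
      (\<integral>\<^sup>+\<omega>. ennreal (min 1 (norm (X (S n \<omega> + e) \<omega> - X (S n \<omega>) \<omega>))) \<partial>M) \<le> (\<integral>\<^sup>+\<omega>. ennreal (min 1 (norm (X e \<omega>))) \<partial>M)"
  shows "AE \<omega> in M. (\<lambda>n. X (S n \<omega>) \<omega>) \<longlonglongrightarrow> X (T \<omega>) \<omega>"
proof -
  define F where "F k n \<omega> = ennreal (min 1 (norm (X (S n \<omega> + 1 / real (Suc k)) \<omega> - X (S n \<omega>) \<omega>)))" for k n \<omega>
  have [measurable]: "(\<lambda>\<omega>. X (S n \<omega>) \<omega>) \<in> borel_measurable M" "(\<lambda>\<omega>. X (S n \<omega> + 1 / real (Suc k)) \<omega>) \<in> borel_measurable M" for n k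
    using S0 by (auto intro!: measurable_random_time add_nonneg_nonneg)
  have Fm[measurable]: "F k n \<in> borel_measurable M" for k n unfolding F_def by measurable
  have "(\<integral>\<^sup>+\<omega>. liminf (\<lambda>k. liminf (\<lambda>n. F k n \<omega>)) \<partial>M) \<le> liminf (\<lambda>k. \<integral>\<^sup>+\<omega>. liminf (\<lambda>n. F k n \<omega>) \<partial>M)"
    by (rule nn_integral_liminf) measurable
  also have "\<dots> \<le> liminf (\<lambda>k. \<integral>\<^sup>+\<omega>. ennreal (min 1 (norm (X (1 / real (Suc k)) \<omega>))) \<partial>M)"
  proof (intro Liminf_mono always_eventually allI)
    fix k
    have "(\<integral>\<^sup>+\<omega>. liminf (\<lambda>n. F k n \<omega>) \<partial>M) \<le> liminf (\<lambda>n. \<integral>\<^sup>+\<omega>. F k n \<omega> \<partial>M)"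
      by (rule nn_integral_liminf) measurable
    also have "\<dots> \<le> liminf (\<lambda>n::nat. \<integral>\<^sup>+\<omega>. ennreal (min 1 (norm (X (1 / real (Suc k)) \<omega>))) \<partial>M)"
      unfolding F_def by (intro Liminf_mono always_eventually allI incr) simp
    finally show "(\<integral>\<^sup>+\<omega>. liminf (\<lambda>n. F k n \<omega>) \<partial>M) \<le> (\<integral>\<^sup>+\<omega>. ennreal (min 1 (norm (X (1 / real (Suc k)) \<omega>))) \<partial>M)"
      by (simp add: Liminf_const)
  qed
  also have "\<dots> = 0"
    by (rule lim_imp_Liminf[OF _ increment_tendsto_0]) simp
  finally have "(\<integral>\<^sup>+\<omega>. liminf (\<lambda>k. liminf (\<lambda>n. F k n \<omega>)) \<partial>M) = 0" by simp
  then have "AE \<omega> in M. liminf (\<lambda>k. liminf (\<lambda>n. F k n \<omega>)) = 0"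
    by (subst (asm) nn_integral_0_iff_AE) auto
  then show ?thesis
  proof eventually_elim
    case (elim \<omega>)
    let ?p = "\<lambda>t. X t \<omega>"
    obtain Y where Y: "(\<lambda>n. ?p (S n \<omega>)) \<longlonglongrightarrow> Y"
      using cadlag_increasing_limit[OF X_cadlag[of \<omega>] lim[of \<omega>] inc[of \<omega>] S0] by blast
    \<comment> \<open>The limit is the left limit at \<open>T + 1/(k+1)\<close>, or the value there if the \<open>S n\<close> reach \<open>T\<close>.\<close>
    have "\<exists>z. (\<lambda>n. ?p (S n \<omega> + 1 / real (Suc k))) \<longlonglongrightarrow> z" for k
    proof -
      have "(\<lambda>n. S n \<omega> + 1 / real (Suc k)) \<longlonglongrightarrow> T \<omega> + 1 / real (Suc k)"
        by (intro tendsto_intros lim)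
      moreover have "incseq (\<lambda>n. S n \<omega> + 1 / real (Suc k))"
        using inc[of \<omega>] by (auto simp: incseq_def)
      ultimately show ?thesis
        using cadlag_increasing_limit[OF X_cadlag, of "\<lambda>n. S n \<omega> + 1 / real (Suc k)"] S0 by (metis add_nonneg_nonneg divide_nonneg_nonneg of_nat_0_le_iff zero_le_one)
    qed
    then obtain Z where Z: "(\<lambda>n. ?p (S n \<omega> + 1 / real (Suc k))) \<longlonglongrightarrow> Z k" for k
      by metis
    have T0: "0 \<le> T \<omega>" by (rule LIMSEQ_le_const[OF lim]) (use S0 in blast)
    have ZT: "Z \<longlonglongrightarrow> ?p (T \<omega>)"
    proof (rule tendstoI)
      fix e :: real assume "e > 0"
      then have "\<forall>\<^sub>F y in at_right (T \<omega>). dist (?p y) (?p (T \<omega>)) < e / 2"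
        using X_right[OF T0] by (intro tendstoD) auto
      then obtain b where b: "b > T \<omega>" "\<And>y. T \<omega> < y \<Longrightarrow> y < b \<Longrightarrow> dist (?p y) (?p (T \<omega>)) < e / 2"
        by (auto simp: eventually_at_right_field)
      have "\<forall>\<^sub>F k in sequentially. 1 / real (Suc k) < b - T \<omega>"
        using LIMSEQ_inverse_real_of_nat b(1) by (intro order_tendstoD) (auto simp: inverse_eq_divide)
      then show "\<forall>\<^sub>F k in sequentially. dist (Z k) (?p (T \<omega>)) < e"
      proof eventually_elim
        case (elim k)
        have Sk: "(\<lambda>n. S n \<omega> + 1 / real (Suc k)) \<longlonglongrightarrow> T \<omega> + 1 / real (Suc k)"
          by (intro tendsto_intros lim)
        have "\<forall>\<^sub>F n in sequentially. T \<omega> < S n \<omega> + 1 / real (Suc k)"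
          using Sk by (rule order_tendstoD) simp
        moreover have "\<forall>\<^sub>F n in sequentially. S n \<omega> + 1 / real (Suc k) < b"
          using Sk by (rule order_tendstoD) (use elim in linarith)
        ultimately have "\<forall>\<^sub>F n in sequentially. dist (?p (S n \<omega> + 1 / real (Suc k))) (?p (T \<omega>)) \<le> e / 2"
          by eventually_elim (intro less_imp_le b(2))
        then have "dist (Z k) (?p (T \<omega>)) \<le> e / 2"
          by (intro tendsto_upperbound[OF tendsto_dist[OF Z tendsto_const]]) auto
        then show ?case using \<open>e > 0\<close> by simp
      qed
    qed
    have "liminf (\<lambda>n. F k n \<omega>) = ennreal (min 1 (norm (Z k - Y)))" for k
      unfolding F_def by (rule lim_imp_Liminf) (rule sequentially_bot, intro tendsto_ennrealI tendsto_intros Z Y)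
    moreover have "liminf (\<lambda>k. ennreal (min 1 (norm (Z k - Y)))) = ennreal (min 1 (norm (?p (T \<omega>) - Y)))"
      by (rule lim_imp_Liminf) (auto intro!: tendsto_ennrealI tendsto_intros ZT)
    ultimately have "ennreal (min 1 (norm (?p (T \<omega>) - Y))) = 0" using elim by simp
    then have "Y = ?p (T \<omega>)" by (simp add: ennreal_eq_0_iff min_def split: if_splits)
    then show ?case using Y by simp
  qed
qed

end

section \<open>The exit from an open set\<close>

lemma shrinking_neighbourhoods_decreasing:
  "{y. \<exists>a\<in>F. dist (x + y) a < 1 / real (Suc (Suc n))} \<subseteq> {y. \<exists>a\<in>F. dist (x + y) a < 1 / real (Suc n)}"
proof -
  have "1 / real (Suc (Suc n)) \<le> 1 / real (Suc n)" by (simp add: field_simps)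
  then show ?thesis by (auto intro: less_le_trans)
qed

lemma closure_shrinking_neighbourhoods:
  fixes U :: "'a::real_normed_vector set"
  assumes U: "open U" and z: "z \<longlonglongrightarrow> l"
    and mem: "\<And>n. z n \<in> closure {y. \<exists>a\<in>-U. dist (x + y) a < 1 / real (Suc n)}"
  shows "x + l \<notin> U"
proof
  assume "x + l \<in> U"
  then obtain r where r: "r > 0" "\<And>y. dist y (x + l) < r \<Longrightarrow> y \<in> U"
    using U by (auto simp: open_dist)
  have "\<forall>\<^sub>F n in sequentially. dist (z n) l < r / 3"
    using z r by (intro tendstoD) auto
  moreover have "\<forall>\<^sub>F n in sequentially. 1 / real (Suc n) < r / 3"
    using LIMSEQ_inverse_real_of_nat r(1) by (intro order_tendstoD) (auto simp: inverse_eq_divide)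
  ultimately have "\<forall>\<^sub>F n in sequentially. dist (z n) l < r / 3 \<and> 1 / real (Suc n) < r / 3"
    by eventually_elim simp
  then obtain n where n: "dist (z n) l < r / 3" "1 / real (Suc n) < r / 3"
    by (auto simp: eventually_sequentially)
  obtain y a where y: "a \<notin> U" "dist (x + y) a < 1 / real (Suc n)" "dist y (z n) < r / 3"
    using mem[of n] r(1) unfolding closure_approachable by (auto dest: spec[of _ "r / 3"])
  have "dist (x + y) (x + l) \<le> dist y (z n) + dist (z n) l"
    by (simp add: dist_norm) (metis dist_norm dist_triangle)
  then have "dist a (x + l) < r"
    using n y dist_triangle[of a "x + l" "x + y"] by (simp add: dist_commute)
  then show False using r(2) y(1) by blast
qed

text \<open>
  The deterministic part of the exit argument, for a path that is continuous along the hitting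
  times of the neighbourhoods of \<open>-U\<close>.  Since \<open>T c\<close> is at most every time spent outside \<open>U\<close>, and the path
  is outside \<open>U\<close> at time \<open>T c\<close> unless the cap \<open>c\<close> intervened, \<open>T c\<close> is the exit time as soon as
  \<open>c\<close> exceeds it.  If the path never leaves \<open>U\<close>, the cap always intervenes and both sides vanish.
\<close>

lemma exit_by_hitting:
  fixes p :: "real \<Rightarrow> 'a::real_normed_vector" and U :: "'a set" and x :: 'a
  defines "G \<equiv> \<lambda>n. {y. \<exists>a\<in>-U. dist (x + y) a < 1 / real (Suc n)}"
  assumes p: "cadlag p" "p 0 = 0" and U: "open U" "x \<in> U"
    and T: "\<And>c::nat. (\<lambda>n. hit (G n) (real c) p) \<longlonglongrightarrow> T c"
    and cont: "\<And>c::nat. (\<lambda>n. p (hit (G n) (real c) p)) \<longlonglongrightarrow> p (T c)"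
  shows "\<forall>\<^sub>F c in sequentially. (if T c < real c then u (x + p (T c)) else 0) = exit_value u U (\<lambda>t. x + p t)"
proof -
  have Tle: "T c \<le> t" if "0 \<le> t" "x + p t \<notin> U" for c t
  proof (rule LIMSEQ_le_const2[OF T], intro exI allI impI)
    fix n
    show "hit (G n) (real c) p \<le> t"
      using that by (intro hit_le_time) (auto simp: G_def intro!: bexI[of _ "x + p t"])
  qed
  have T0: "0 \<le> T c" for c
    by (rule LIMSEQ_le_const[OF T]) (auto intro!: hit_nonneg)
  have anti: "G (Suc n) \<subseteq> G n" for n
  proof -
    show ?thesis unfolding G_def by (rule shrinking_neighbourhoods_decreasing)
  qed
  have inc: "incseq (\<lambda>n. hit (G n) (real c) p)" for c
    by (rule incseq_SucI, rule hit_antimono, rule anti)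
  have exit: "x + p (T c) \<notin> U" "0 < T c" "exit_time U (\<lambda>t. x + p t) = ereal (T c)" if c: "T c < real c" for c
  proof -
    have "hit (G n) (real c) p < real c" for n
      using incseq_le[OF inc T, of n c] c by simp
    then have "p (hit (G n) (real c) p) \<in> closure (G n)" for n
      by (intro hit_in_closure p) auto
    then show out: "x + p (T c) \<notin> U"
      unfolding G_def by (intro closure_shrinking_neighbourhoods[OF U(1) cont[of c, unfolded G_def]])
    show pos: "0 < T c"
      using T0[of c] out U(2) p(2) by (cases "T c = 0") auto
    show "exit_time U (\<lambda>t. x + p t) = ereal (T c)"
      unfolding exit_time_def
    proof (rule antisym)
      show "Inf {ereal t |t. 0 < t \<and> x + p t \<notin> U} \<le> ereal (T c)"
        using out pos by (intro Inf_lower) auto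
      show "ereal (T c) \<le> Inf {ereal t |t. 0 < t \<and> x + p t \<notin> U}"
        by (rule Inf_greatest) (auto intro!: Tle)
    qed
  qed
  show ?thesis
  proof (cases "exit_time U (\<lambda>t. x + p t) = \<infinity>")
    case True
    then have "\<not> T c < real c" for c using exit(3)[of c] by auto
    then show ?thesis using True by (simp add: exit_value_def)
  next
    case False
    have "{ereal t |t. 0 < t \<and> x + p t \<notin> U} \<noteq> {}"
    proof
      assume "{ereal t |t. 0 < t \<and> x + p t \<notin> U} = {}"
      then have "exit_time U (\<lambda>t. x + p t) = \<infinity>"
        unfolding exit_time_def by (simp only: Inf_empty top_ereal_def)
      then show False using False by simp
    qed
    then obtain t where t: "0 < t" "x + p t \<notin> U" by blast
    obtain N :: nat where N: "t < real N" using reals_Archimedean2 by blast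
    have "(if T c < real c then u (x + p (T c)) else 0) = exit_value u U (\<lambda>t. x + p t)" if "N \<le> c" for c
    proof -
      have "T c < real c" using Tle[of t c] t N that by simp
      then show ?thesis using exit(3)[of c] by (simp add: exit_value_def)
    qed
    then show ?thesis by (rule eventually_sequentiallyI)
  qed
qed

lemma (in regular_levy) exit_value_supermartingale:
  fixes u :: "'a \<Rightarrow> real"
  assumes U: "open U" "x \<in> U" and lsc: "lower_semicontinuous u" and nonneg: "\<And>z. 0 \<le> u z"
    and mean: "\<And>z t. 0 \<le> t \<Longrightarrow> (\<integral>\<^sup>+y. ennreal (u (z + y)) \<partial>distr M borel (X t)) \<le> ennreal (u z)"
  obtains g where "g \<in> borel_measurable M" "\<And>\<omega>. 0 \<le> g \<omega>" "AE \<omega> in M. exit_value u U (\<lambda>t. x + X t \<omega>) = g \<omega>"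
    "(\<integral>\<^sup>+\<omega>. ennreal (g \<omega>) \<partial>M) \<le> ennreal (u x)"
proof -
  have [measurable]: "u \<in> borel_measurable borel" using lsc by (rule lower_semicontinuous_measurable)
  define G where "G n = {y. \<exists>a\<in>-U. dist (x + y) a < 1 / real (Suc n)}" for n
  have G: "open (G n)" for n
  proof -
    have "G n = (\<Union>a\<in>-U. {y. dist (x + y) a < 1 / real (Suc n)})" by (auto simp: G_def)
    then show ?thesis by (auto intro!: open_Collect_less continuous_intros)
  qed
  define S where "S c n \<omega> = hit (G n) (real c) (\<lambda>t. X t \<omega>)" for c n \<omega>
  define T where "T c \<omega> = lim (\<lambda>n. S c n \<omega>)" for c \<omega>
  have Sm[measurable]: "S c n \<in> borel_measurable M" for c n
    unfolding S_def by (intro measurable_hit G)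
  have S0: "0 \<le> S c n \<omega>" for c n \<omega> unfolding S_def by (intro hit_nonneg) simp
  have inc: "incseq (\<lambda>n. S c n \<omega>)" for c \<omega>
  proof (rule incseq_SucI)
    fix n
    have "G (Suc n) \<subseteq> G n" unfolding G_def by (rule shrinking_neighbourhoods_decreasing)
    then show "S c n \<omega> \<le> S c (Suc n) \<omega>" unfolding S_def by (rule hit_antimono)
  qed
  have lim: "(\<lambda>n. S c n \<omega>) \<longlonglongrightarrow> T c \<omega>" for c \<omega>
  proof -
    have "S c n \<omega> \<le> real c" for n unfolding S_def by (rule hit_le)
    then show ?thesis
      using incseq_convergent[OF inc, of c \<omega> "real c"] unfolding T_def by (metis limI)
  qed
  have Tm[measurable]: "T c \<in> borel_measurable M" for c
    by (rule borel_measurable_LIMSEQ_real[OF lim]) measurable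
  have T0: "0 \<le> T c \<omega>" for c \<omega> by (rule LIMSEQ_le_const[OF lim]) (use S0 in blast)
  have [measurable]: "(\<lambda>\<omega>. X (T c \<omega>) \<omega>) \<in> borel_measurable M" "(\<lambda>\<omega>. X (S c n \<omega>) \<omega>) \<in> borel_measurable M" for c n
    using T0 S0 by (auto intro!: measurable_random_time)
  have qlc: "AE \<omega> in M. (\<lambda>n. X (S c n \<omega>) \<omega>) \<longlonglongrightarrow> X (T c \<omega>) \<omega>" for c
  proof (rule quasi_left_continuous[OF Sm S0 inc lim])
    fix n and e :: real assume "0 \<le> e"
    then show "(\<integral>\<^sup>+\<omega>. ennreal (min 1 (norm (X (S c n \<omega> + e) \<omega> - X (S c n \<omega>) \<omega>))) \<partial>M) \<le> (\<integral>\<^sup>+\<omega>. ennreal (min 1 (norm (X e \<omega>))) \<partial>M)"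
      unfolding S_def by (intro hit_increment[where f = "\<lambda>z. min 1 (norm z)"] G) (auto intro!: continuous_intros)
  qed
  \<comment> \<open>Random variables that eventually equal the exit value as the cap \<open>c\<close> grows.\<close>
  define h where "h c \<omega> = (if T c \<omega> < real c then u (x + X (T c \<omega>) \<omega>) else 0)" for c \<omega>
  have [measurable]: "h c \<in> borel_measurable M" for c unfolding h_def by measurable
  have h0: "0 \<le> h c \<omega>" for c \<omega> using nonneg by (simp add: h_def)
  have ev: "AE \<omega> in M. \<forall>\<^sub>F c in sequentially. h c \<omega> = exit_value u U (\<lambda>t. x + X t \<omega>)"
  proof -
    have "AE \<omega> in M. \<forall>c. (\<lambda>n. X (S c n \<omega>) \<omega>) \<longlonglongrightarrow> X (T c \<omega>) \<omega>"
      using qlc by (simp add: AE_all_countable)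
    then show ?thesis
    proof eventually_elim
      case (elim \<omega>)
      show ?case unfolding h_def
        using elim lim[unfolded S_def G_def] X_cadlag X_0 U unfolding S_def G_def
        by (intro exit_by_hitting[where p = "\<lambda>t. X t \<omega>" and T = "\<lambda>c. T c \<omega>"]) auto
    qed
  qed
  have hint: "(\<integral>\<^sup>+\<omega>. ennreal (h c \<omega>) \<partial>M) \<le> ennreal (u x)" for c
  proof -
    have "(\<integral>\<^sup>+\<omega>. ennreal (h c \<omega>) \<partial>M) \<le> (\<integral>\<^sup>+\<omega>. liminf (\<lambda>n. ennreal (u (x + X (S c n \<omega>) \<omega>))) \<partial>M)"
    proof (rule nn_integral_mono_AE)
      show "AE \<omega> in M. ennreal (h c \<omega>) \<le> liminf (\<lambda>n. ennreal (u (x + X (S c n \<omega>) \<omega>)))"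
        using qlc[of c]
      proof eventually_elim
        case (elim \<omega>)
        have "ennreal (h c \<omega>) \<le> ennreal (u (x + X (T c \<omega>) \<omega>))"
          using nonneg by (auto simp: h_def)
        also have "\<dots> \<le> liminf (\<lambda>n. ennreal (u (x + X (S c n \<omega>) \<omega>)))"
          by (intro lower_semicontinuous_le_liminf lsc tendsto_intros elim)
        finally show ?case .
      qed
    qed
    also have "\<dots> \<le> liminf (\<lambda>n. \<integral>\<^sup>+\<omega>. ennreal (u (x + X (S c n \<omega>) \<omega>)) \<partial>M)"
      by (rule nn_integral_liminf) measurable
    also have "\<dots> \<le> liminf (\<lambda>n::nat. ennreal (u x))"
      unfolding S_def by (intro Liminf_mono always_eventually allI hit_supermartingale G lsc mean)
    finally show ?thesis by (simp add: Liminf_const)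
  qed
  define g where "g \<omega> = enn2real (liminf (\<lambda>c. ennreal (h c \<omega>)))" for \<omega>
  show thesis
  proof (rule that[of g])
    show "g \<in> borel_measurable M" unfolding g_def by measurable
    show "0 \<le> g \<omega>" for \<omega> by (simp add: g_def)
    have e: "AE \<omega> in M. liminf (\<lambda>c. ennreal (h c \<omega>)) = ennreal (exit_value u U (\<lambda>t. x + X t \<omega>))"
      using ev
    proof eventually_elim
      case (elim \<omega>)
      show ?case
        by (rule lim_imp_Liminf) (use elim in \<open>auto intro!: tendsto_eventually elim!: eventually_mono\<close>)
    qed
    have ge0: "0 \<le> exit_value u U p" for p using nonneg by (simp add: exit_value_def)
    show "AE \<omega> in M. exit_value u U (\<lambda>t. x + X t \<omega>) = g \<omega>"
      using e by eventually_elim (simp add: g_def ge0)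
    have "(\<integral>\<^sup>+\<omega>. ennreal (g \<omega>) \<partial>M) = (\<integral>\<^sup>+\<omega>. liminf (\<lambda>c. ennreal (h c \<omega>)) \<partial>M)"
      by (rule nn_integral_cong_AE) (use e in \<open>auto simp: g_def ge0 elim!: eventually_mono\<close>)
    also have "\<dots> \<le> liminf (\<lambda>c. \<integral>\<^sup>+\<omega>. ennreal (h c \<omega>) \<partial>M)"
      by (rule nn_integral_liminf) measurable
    also have "\<dots> \<le> liminf (\<lambda>c::nat. ennreal (u x))"
      by (intro Liminf_mono always_eventually allI hint)
    finally show "(\<integral>\<^sup>+\<omega>. ennreal (g \<omega>) \<partial>M) \<le> ennreal (u x)" by (simp add: Liminf_const)
  qed
qed


section \<open>From the stable process to a regular version\<close>

text \<open>
  The positions at the times \<open>id\<close>, \<open>i \<le> j\<close>, are almost surely sums of the increments before \<open>jd\<close>,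
  which form a vector independent of the increment after \<open>jd\<close>.
\<close>

lemma stable_process_markov:
  fixes X :: "real \<Rightarrow> 'w \<Rightarrow> 'a::euclidean_space"
  assumes X: "stable_process \<alpha> M X" and d: "0 \<le> d" and e: "0 \<le> e"
    and C[measurable]: "\<And>i. C i \<in> sets borel"
    and f[measurable]: "case_prod f \<in> borel_measurable (borel \<Otimes>\<^sub>M borel)"
  shows "(\<integral>\<^sup>+\<omega>. indicator {\<omega>. \<forall>i\<le>j. X (real i * d) \<omega> \<in> C i} \<omega>
           * f (X (real j * d) \<omega>) (X (real j * d + e) \<omega> - X (real j * d) \<omega>) \<partial>M)
      = (\<integral>\<^sup>+\<omega>. indicator {\<omega>. \<forall>i\<le>j. X (real i * d) \<omega> \<in> C i} \<omega>
           * (\<integral>\<^sup>+y. f (X (real j * d) \<omega>) y \<partial>distr M borel (X e)) \<partial>M)"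
proof -
  interpret prob_space M using X by (simp add: stable_process_def)
  have Xm[measurable]: "X t \<in> borel_measurable M" if "0 \<le> t" for t
    using X that by (simp add: stable_process_def)
  have [measurable]: "X (real i * d) \<in> borel_measurable M" "X (real i * d + e) \<in> borel_measurable M"
    "X e \<in> borel_measurable M" for i
    using d e by (auto intro!: Xm)
  let ?\<nu> = "distr M borel (X e)"
  interpret \<nu>: prob_space ?\<nu> by (rule prob_space_distr) measurable
  \<comment> \<open>The grid up to \<open>jd\<close>, followed by \<open>jd + e\<close> forever, so that the \<open>j\<close>-th increment is the one after
    \<open>jd\<close>.\<close>
  define t where "t i = (if i \<le> j then real i * d else real j * d + e)" for i :: nat
  define D where "D i \<omega> = X (t (Suc i)) \<omega> - X (t i) \<omega>" for i \<omega>
  have "mono t"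
    unfolding mono_iff_le_Suc
  proof
    fix i
    have "real i * d \<le> real (Suc i) * d" using d by (intro mult_right_mono) auto
    then show "t i \<le> t (Suc i)" using e by (cases "i = j") (auto simp: t_def)
  qed
  then have t: "0 \<le> t 0 \<and> mono t" by (simp add: t_def)
  have "\<forall>(t :: nat \<Rightarrow> real) n. 0 \<le> t 0 \<and> mono t \<longrightarrow>
      indep_vars (\<lambda>_. borel) (\<lambda>i \<omega>. X (t (Suc i)) \<omega> - X (t i) \<omega>) {..<n}"
    using X unfolding stable_process_def by (elim conjE)
  from this[rule_format, OF t, of "Suc j"] have ind: "indep_vars (\<lambda>_. borel) D {..<Suc j}"
    unfolding D_def[abs_def] .
  define V where "V \<omega> = restrict (\<lambda>i. D i \<omega>) {..<j}" for \<omega>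
  have Dj: "D j = (\<lambda>\<omega>. X (real j * d + e) \<omega> - X (real j * d) \<omega>)"
    by (simp add: D_def t_def fun_eq_iff)
  have [measurable]: "D i \<in> borel_measurable M" for i
    using d e unfolding D_def t_def by (auto intro!: borel_measurable_diff Xm)
  have Vm[measurable]: "V \<in> measurable M (PiM {..<j} (\<lambda>_. borel))"
    unfolding V_def by measurable
  \<comment> \<open>Independence relates random variables of one type, hence the increment as a one-component vector.\<close>
  define R where "R \<omega> = restrict (\<lambda>i. D i \<omega>) {j}" for \<omega>
  have [measurable]: "R \<in> measurable M (PiM {j} (\<lambda>_. borel))"
    unfolding R_def by measurable
  have Rj: "R \<omega> j = D j \<omega>" for \<omega> by (simp add: R_def)
  let ?V = "distr M (PiM {..<j} (\<lambda>_. borel)) V"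
  let ?R = "distr M (PiM {j} (\<lambda>_. borel)) R"
  interpret R: prob_space ?R by (rule prob_space_distr) measurable
  have "indep_var (PiM {..<j} (\<lambda>_. borel)) V (PiM {j} (\<lambda>_. borel)) R"
    unfolding V_def R_def by (rule indep_var_restrict[OF ind]) auto
  then have prod: "?V \<Otimes>\<^sub>M ?R = distr M (PiM {..<j} (\<lambda>_. borel) \<Otimes>\<^sub>M PiM {j} (\<lambda>_. borel)) (\<lambda>\<omega>. (V \<omega>, R \<omega>))"
    by (simp add: indep_var_distribution_eq)
  have "\<forall>s\<ge>0. \<forall>t\<ge>0. distr M borel (\<lambda>\<omega>. X (s + t) \<omega> - X s \<omega>) = distr M borel (X t)"
    using X unfolding stable_process_def by (elim conjE)
  then have \<nu>: "distr M borel (D j) = ?\<nu>"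
    using d e unfolding Dj by simp
  have [measurable]: "(\<lambda>q. q j) \<in> borel_measurable (PiM {j} (\<lambda>_. borel))"
    by (rule measurable_component_singleton) simp
  have R: "(\<integral>\<^sup>+q. h (q j) \<partial>?R) = (\<integral>\<^sup>+y. h y \<partial>?\<nu>)" if [measurable]: "h \<in> borel_measurable borel" for h :: "'a \<Rightarrow> ennreal"
  proof -
    have "(\<integral>\<^sup>+q. h (q j) \<partial>?R) = (\<integral>\<^sup>+\<omega>. h (D j \<omega>) \<partial>M)"
      by (subst nn_integral_distr) (simp_all add: Rj)
    also have "\<dots> = (\<integral>\<^sup>+y. h y \<partial>?\<nu>)"
      unfolding \<nu>[symmetric] by (subst nn_integral_distr) simp_all
    finally show ?thesis .
  qed
  define W where "W p i = (\<Sum>k<i. p k)" for p :: "nat \<Rightarrow> 'a" and i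
  have Wm[measurable]: "(\<lambda>p. W p i) \<in> borel_measurable (PiM {..<j} (\<lambda>_. borel))" if "i \<le> j" for i
    unfolding W_def using that by (auto intro!: borel_measurable_sum measurable_component_singleton)
  have WV: "AE \<omega> in M. \<forall>i\<le>j. W (V \<omega>) i = X (real i * d) \<omega>"
  proof -
    have "AE \<omega> in M. X 0 \<omega> = 0" using X by (simp add: stable_process_def)
    then show ?thesis
    proof eventually_elim
      case (elim \<omega>)
      have "W (V \<omega>) i = X (real i * d) \<omega>" if "i \<le> j" for i
      proof -
        have "W (V \<omega>) i = (\<Sum>k<i. X (real (Suc k) * d) \<omega> - X (real k * d) \<omega>)"
          unfolding W_def V_def using that by (intro sum.cong) (auto simp: D_def t_def)
        also have "\<dots> = X (real i * d) \<omega>"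
          using elim by (subst sum_lessThan_telescope) simp
        finally show ?thesis .
      qed
      then show ?case by blast
    qed
  qed
  define A where "A = {p \<in> space (PiM {..<j} (\<lambda>_. borel)). \<forall>i\<in>{..j}. W p i \<in> C i}"
  have [measurable]: "A \<in> sets (PiM {..<j} (\<lambda>_. borel))"
    unfolding A_def
  proof (rule sets.sets_Collect_finite_All)
    fix i assume "i \<in> {..j}"
    then have [measurable]: "(\<lambda>p. W p i) \<in> borel_measurable (PiM {..<j} (\<lambda>_. borel))" by (intro Wm) simp
    show "{p \<in> space (PiM {..<j} (\<lambda>_. borel)). W p i \<in> C i} \<in> sets (PiM {..<j} (\<lambda>_. borel))"
      by measurable
  qed simp
  note [measurable] = Wm[OF order_refl]
  have ind_eq: "AE \<omega> in M. (indicator {\<omega>. \<forall>i\<le>j. X (real i * d) \<omega> \<in> C i} \<omega> :: ennreal) = indicator A (V \<omega>)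
      \<and> X (real j * d) \<omega> = W (V \<omega>) j"
    using WV AE_space
  proof eventually_elim
    case (elim \<omega>)
    then have "V \<omega> \<in> space (PiM {..<j} (\<lambda>_. borel))" by (intro measurable_space[OF Vm])
    then show ?case using elim by (auto simp: A_def indicator_def)
  qed
  have "(\<integral>\<^sup>+\<omega>. indicator {\<omega>. \<forall>i\<le>j. X (real i * d) \<omega> \<in> C i} \<omega>
           * f (X (real j * d) \<omega>) (X (real j * d + e) \<omega> - X (real j * d) \<omega>) \<partial>M)
     = (\<integral>\<^sup>+\<omega>. indicator A (V \<omega>) * f (W (V \<omega>) j) (D j \<omega>) \<partial>M)"
    by (rule nn_integral_cong_AE, rule eventually_mono[OF ind_eq]) (simp add: Dj)
  also have "\<dots> = (\<integral>\<^sup>+q. indicator A (fst q) * f (W (fst q) j) (snd q j) \<partial>(?V \<Otimes>\<^sub>M ?R))"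
    unfolding prod by (subst nn_integral_distr) (simp_all add: Rj)
  also have "\<dots> = (\<integral>\<^sup>+p. (\<integral>\<^sup>+q. indicator A p * f (W p j) (q j) \<partial>?R) \<partial>?V)"
    by (subst R.nn_integral_fst[symmetric]) (simp_all cong: measurable_cong_sets sets_pair_measure_cong)
  also have "\<dots> = (\<integral>\<^sup>+p. indicator A p * (\<integral>\<^sup>+y. f (W p j) y \<partial>?\<nu>) \<partial>?V)"
    by (subst R[symmetric]) (simp_all add: nn_integral_cmult)
  also have "\<dots> = (\<integral>\<^sup>+\<omega>. indicator A (V \<omega>) * (\<integral>\<^sup>+y. f (W (V \<omega>) j) y \<partial>?\<nu>) \<partial>M)"
    by (subst nn_integral_distr) auto
  also have "\<dots> = (\<integral>\<^sup>+\<omega>. indicator {\<omega>. \<forall>i\<le>j. X (real i * d) \<omega> \<in> C i} \<omega>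
           * (\<integral>\<^sup>+y. f (X (real j * d) \<omega>) y \<partial>?\<nu>) \<partial>M)"
    by (rule nn_integral_cong_AE, rule eventually_mono[OF ind_eq]) simp
  finally show ?thesis .
qed

text \<open>
  Freeze the process at the origin on a measurable null set that contains all irregular paths.
\<close>

lemma stable_process_regular_version:
  fixes X :: "real \<Rightarrow> 'w \<Rightarrow> 'a::euclidean_space"
  assumes X: "stable_process \<alpha> M X"
  obtains X' where "regular_levy M X'" "AE \<omega> in M. \<forall>t. X' t \<omega> = X t \<omega>"
    "\<And>t. 0 \<le> t \<Longrightarrow> distr M borel (X' t) = distr M borel (X t)"
proof -
  interpret prob_space M using X by (simp add: stable_process_def)
  have "AE \<omega> in M. X 0 \<omega> = 0 \<and> cadlag (\<lambda>t. X t \<omega>)"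
    using X unfolding stable_process_def by (intro AE_conjI) auto
  then obtain N where N: "{\<omega> \<in> space M. \<not> (X 0 \<omega> = 0 \<and> cadlag (\<lambda>t. X t \<omega>))} \<subseteq> N" "emeasure M N = 0" "N \<in> sets M"
    by (rule AE_E)
  define X' where "X' t \<omega> = (if \<omega> \<in> space M - N then X t \<omega> else 0)" for t \<omega>
  have "N \<in> null_sets M" using N by auto
  then have "AE \<omega> in M. \<omega> \<in> space M - N"
    using AE_not_in AE_space by (auto intro: AE_conjI)
  then have eq: "AE \<omega> in M. \<forall>t. X' t \<omega> = X t \<omega>"
    by eventually_elim (simp add: X'_def)
  have Xm: "X t \<in> borel_measurable M" if "0 \<le> t" for t
    using X that by (simp add: stable_process_def)
  have Xm': "X' t \<in> borel_measurable M" if "0 \<le> t" for t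
    unfolding X'_def[abs_def] using N(3) Xm[OF that] by measurable
  have distr: "distr M borel (X' t) = distr M borel (X t)" if "0 \<le> t" for t
    by (rule distr_cong_AE) (use eq Xm Xm' that in \<open>auto elim!: eventually_mono\<close>)
  have "regular_levy M X'"
  proof
    fix t :: real assume "0 \<le> t" then show "X' t \<in> borel_measurable M" by (rule Xm')
  next
    show "X' 0 \<omega> = 0" for \<omega> using N(1) by (auto simp: X'_def)
    show "cadlag (\<lambda>t. X' t \<omega>)" for \<omega>
    proof (cases "\<omega> \<in> space M - N")
      case True
      then show ?thesis using N(1) by (auto simp: X'_def)
    next
      case False
      then show ?thesis by (auto simp: X'_def cadlag_def intro: exI[of _ 0])
    qed
  next
    fix d e :: real and C :: "nat \<Rightarrow> 'a set" and f :: "'a \<Rightarrow> 'a \<Rightarrow> ennreal" and j :: nat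
    assume a: "0 \<le> d" "0 \<le> e" "\<And>i. C i \<in> sets borel" "case_prod f \<in> borel_measurable (borel \<Otimes>\<^sub>M borel)"
    have "(\<integral>\<^sup>+\<omega>. indicator {\<omega>. \<forall>i\<le>j. X' (real i * d) \<omega> \<in> C i} \<omega>
           * f (X' (real j * d) \<omega>) (X' (real j * d + e) \<omega> - X' (real j * d) \<omega>) \<partial>M)
      = (\<integral>\<^sup>+\<omega>. indicator {\<omega>. \<forall>i\<le>j. X (real i * d) \<omega> \<in> C i} \<omega>
           * f (X (real j * d) \<omega>) (X (real j * d + e) \<omega> - X (real j * d) \<omega>) \<partial>M)"
      by (rule nn_integral_cong_AE) (use eq in \<open>auto simp: indicator_def elim!: eventually_mono\<close>)
    also have "\<dots> = (\<integral>\<^sup>+\<omega>. indicator {\<omega>. \<forall>i\<le>j. X (real i * d) \<omega> \<in> C i} \<omega>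
           * (\<integral>\<^sup>+y. f (X (real j * d) \<omega>) y \<partial>distr M borel (X e)) \<partial>M)"
      by (rule stable_process_markov[OF X a])
    also have "\<dots> = (\<integral>\<^sup>+\<omega>. indicator {\<omega>. \<forall>i\<le>j. X' (real i * d) \<omega> \<in> C i} \<omega>
           * (\<integral>\<^sup>+y. f (X' (real j * d) \<omega>) y \<partial>distr M borel (X' e)) \<partial>M)"
      unfolding distr[OF a(2)]
      by (rule nn_integral_cong_AE) (use eq in \<open>auto simp: indicator_def elim!: eventually_mono\<close>)
    finally show "(\<integral>\<^sup>+\<omega>. indicator {\<omega>. \<forall>i\<le>j. X' (real i * d) \<omega> \<in> C i} \<omega>
           * f (X' (real j * d) \<omega>) (X' (real j * d + e) \<omega> - X' (real j * d) \<omega>) \<partial>M)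
      = (\<integral>\<^sup>+\<omega>. indicator {\<omega>. \<forall>i\<le>j. X' (real i * d) \<omega> \<in> C i} \<omega>
           * (\<integral>\<^sup>+y. f (X' (real j * d) \<omega>) y \<partial>distr M borel (X' e)) \<partial>M)" .
  qed
  then show thesis using eq distr by (rule that)
qed

section \<open>Conclusion\<close>

lemma L_infinity_loc_locally_integrable:
  assumes "u \<in> L_infinity_loc"
  shows "locally_integrable u"
  unfolding locally_integrable_def
proof (intro allI impI)
  fix K :: "'a set" assume K: "compact K"
  from assms K obtain C where "AE y in lborel. y \<in> K \<longrightarrow> \<bar>u y\<bar> \<le> C" and m: "u \<in> borel_measurable borel"
    unfolding L_infinity_loc_def by blast
  then show "set_integrable lborel K u"
    unfolding set_integrable_def using K emeasure_bounded_finite[OF compact_imp_bounded[OF K]]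
    by (intro integrableI_bounded_set_indicator[where B = C])
       (auto dest: compact_imp_closed)
qed

lemma integrable_completion_AE_nonneg:
  fixes f g :: "'w \<Rightarrow> real"
  assumes g: "g \<in> borel_measurable M" "\<And>\<omega>. 0 \<le> g \<omega>" and eq: "AE \<omega> in M. f \<omega> = g \<omega>"
    and le: "(\<integral>\<^sup>+\<omega>. ennreal (g \<omega>) \<partial>M) \<le> ennreal c" and c: "0 \<le> c"
  shows "integrable (completion M) f \<and> (LINT \<omega>|completion M. f \<omega>) \<le> c"
proof -
  have gi: "integrable M g"
    using g le by (intro integrableI_nonneg) (auto intro: le_less_trans)
  have eq': "AE \<omega> in completion M. f \<omega> = g \<omega>" using eq by (rule AE_completion)
  have fm: "f \<in> borel_measurable (completion M)"
  proof (rule measurableI)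
    fix B :: "real set" assume B: "B \<in> sets borel"
    show "f -` B \<inter> space (completion M) \<in> sets (completion M)"
    proof (rule completion.in_sets_AE)
      show "AE \<omega> in completion M. \<omega> \<in> g -` B \<inter> space M \<longleftrightarrow> \<omega> \<in> f -` B \<inter> space (completion M)"
        using eq' by eventually_elim simp
      show "g -` B \<inter> space M \<in> sets (completion M)"
        using measurable_sets[OF g(1) B] by simp
    qed auto
  qed simp
  have gm: "g \<in> borel_measurable (completion M)" using g(1) by (rule measurable_completion)
  have "integrable (completion M) f"
    using gi integrable_completion[OF g(1)] integrable_cong_AE[OF fm gm eq'] by simp
  moreover have "(LINT \<omega>|completion M. f \<omega>) = (LINT \<omega>|M. g \<omega>)"
    using integral_cong_AE[OF fm gm eq'] integral_completion[OF g(1)] by simp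
  moreover have "(LINT \<omega>|M. g \<omega>) \<le> c"
    using le c nn_integral_eq_integral[OF gi] g(2) by simp
  ultimately show ?thesis by simp
qed

theorem theorem3p10:
  fixes \<alpha> :: real
    and M :: "'w measure"
    and X :: "real \<Rightarrow> 'w \<Rightarrow> real ^ 'n"
    and u :: "real ^ 'n \<Rightarrow> real"
  assumes "CARD('n) \<ge> 3"
    and "\<alpha> \<in> {0<..<2}"
    and "stable_process \<alpha> M X"
    and "\<And>x. u x \<ge> 0"
    and "u \<in> L_infinity_loc \<inter> L_alpha \<alpha>"
    and "superharmonic u"
  shows "alpha_superharmonic M X u"
proof -
  have lsc: "lower_semicontinuous u" using assms(6) by (simp add: superharmonic_def)
  obtain X' where X': "regular_levy M X'" "AE \<omega> in M. \<forall>t. X' t \<omega> = X t \<omega>"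
    "\<And>t. 0 \<le> t \<Longrightarrow> distr M borel (X' t) = distr M borel (X t)"
    using stable_process_regular_version[OF assms(3)] by blast
  interpret regular_levy M X' by fact
  have mean: "(\<integral>\<^sup>+y. ennreal (u (z + y)) \<partial>distr M borel (X' t)) \<le> ennreal (u z)" if t: "0 \<le> t" for z t
    unfolding X'(3)[OF t]
  proof (rule superharmonic_radial_law[OF assms(6,4), where q = "\<lambda>r. complex_of_real (exp (- t * r powr \<alpha>))"])
    have [measurable]: "X t \<in> borel_measurable M"
      using assms(3) t by (simp add: stable_process_def)
    show "prob_space (distr M borel (X t))" by (rule prob_space_distr) measurable
    show "(CLINT y|distr M borel (X t). iexp (\<xi> \<bullet> y)) = complex_of_real (exp (- t * norm \<xi> powr \<alpha>))" for \<xi>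
      using assms(3) t by (subst integral_distr) (auto simp: stable_process_def)
  qed simp
  show ?thesis
    unfolding alpha_superharmonic_def
  proof (intro conjI allI impI ballI)
    show "u \<in> borel_measurable borel" "locally_integrable u"
      using assms(5) by (auto simp: L_infinity_loc_def intro: L_infinity_loc_locally_integrable)
    fix U :: "(real ^ 'n) set" and x assume U: "open U \<and> bounded U" "x \<in> U"
    then obtain g where g: "g \<in> borel_measurable M" "\<And>\<omega>. 0 \<le> g \<omega>"
      and eq: "AE \<omega> in M. exit_value u U (\<lambda>t. x + X' t \<omega>) = g \<omega>"
      and le: "(\<integral>\<^sup>+\<omega>. ennreal (g \<omega>) \<partial>M) \<le> ennreal (u x)"
      using exit_value_supermartingale[OF _ _ lsc assms(4) mean] by blast
    have "AE \<omega> in M. exit_value u U (\<lambda>t. x + X t \<omega>) = g \<omega>"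
      using eq X'(2) by eventually_elim simp
    from integrable_completion_AE_nonneg[OF g this le assms(4)]
    show "integrable (completion M) (\<lambda>\<omega>. exit_value u U (\<lambda>t. x + X t \<omega>))"
      "(LINT \<omega>|completion M. exit_value u U (\<lambda>t. x + X t \<omega>)) \<le> u x" by auto
  qed
qed

end
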